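(* Let $\mathbf{d}$ be a Turing degree with $\mathbf{d}\gg\mathbf{0}'$. Then for every computable sequence $\langle f_i:i\in\omega\rangle$ of functions $f_i:\omega\to\omega$ there is a sequence $A=\langle A_i:i\in\omega\rangle$, each $A_i$ an infinite thin set for $f_i$, such that $\deg(A)'\leq\mathbf{d}$. In particular, every such computable sequence has a low$_2$ such solution $A$ (i.e. $A''\equiv_T\emptyset''$).
   Context: A set $S\subseteq\omega$ is thin for $f:\omega\to\omega$ if there is $c\in\omega$ with $f(x)\neq c$ for all $x\in S$. For degrees $\mathbf{a},\mathbf{b}$, $\mathbf{a}\gg\mathbf{b}$ means every infinite subtree of $2^{<\omega}$ of degree $\mathbf{b}$ has an infinite path of degree at most $\mathbf{a}$. *)

theory Defs
  imports Main "HOL-Library.Nat_Bijection"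
begin

datatype rf = Zer | Suc_f | Proj nat | Comp rf "rf list" | Prec rf rf | Mn rf | Orc

text \<open>Evaluation relation: ev X c xs y means program c with oracle X on argument
list xs halts with output y. Arities are not checked (extra arguments are ignored).\<close>

inductive ev :: "nat set \<Rightarrow> rf \<Rightarrow> nat list \<Rightarrow> nat \<Rightarrow> bool" for X :: "nat set" where
  ev_zer: "ev X Zer xs 0"
| ev_suc: "ev X Suc_f (x # xs) (Suc x)"
| ev_proj: "i < length xs \<Longrightarrow> ev X (Proj i) xs (xs ! i)"
| ev_comp: "list_all2 (\<lambda>g y. ev X g xs y) gs ys \<Longrightarrow> ev X f ys z \<Longrightarrow> ev X (Comp f gs) xs z"
| ev_prec0: "ev X f xs y \<Longrightarrow> ev X (Prec f g) (0 # xs) y"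
| ev_precS: "ev X (Prec f g) (n # xs) y \<Longrightarrow> ev X g (y # n # xs) z
             \<Longrightarrow> ev X (Prec f g) (Suc n # xs) z"
| ev_mn: "ev X f (n # xs) 0 \<Longrightarrow> (\<forall>m<n. \<exists>y. ev X f (m # xs) y \<and> y \<noteq> 0)
          \<Longrightarrow> ev X (Mn f) xs n"
| ev_orc: "ev X Orc (x # xs) (if x \<in> X then 1 else 0)"

definition chi :: "nat set \<Rightarrow> nat \<Rightarrow> nat" where
  "chi A n = (if n \<in> A then 1 else 0)"

definition turing_le :: "nat set \<Rightarrow> nat set \<Rightarrow> bool" where
  "turing_le A B \<longleftrightarrow> (\<exists>c. \<forall>n. ev B c [n] (chi A n))"

definition turing_equiv :: "nat set \<Rightarrow> nat set \<Rightarrow> bool" where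
  "turing_equiv A B \<longleftrightarrow> turing_le A B \<and> turing_le B A"

definition computable2 :: "(nat \<Rightarrow> nat \<Rightarrow> nat) \<Rightarrow> bool" where
  "computable2 F \<longleftrightarrow> (\<exists>c. \<forall>i x. ev {} c [i, x] (F i x))"

fun enc_list :: "nat list \<Rightarrow> nat" where
  "enc_list [] = 0"
| "enc_list (x # xs) = Suc (prod_encode (x, enc_list xs))"

primrec encode :: "rf \<Rightarrow> nat" where
  "encode Zer = prod_encode (0, 0)"
| "encode Suc_f = prod_encode (1, 0)"
| "encode (Proj i) = prod_encode (2, i)"
| "encode (Comp f gs) = prod_encode (3, prod_encode (encode f, enc_list (map encode gs)))"
| "encode (Prec f g) = prod_encode (4, prod_encode (encode f, encode g))"
| "encode (Mn f) = prod_encode (5, encode f)"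
| "encode Orc = prod_encode (6, 0)"

definition jump :: "nat set \<Rightarrow> nat set" where
  "jump X = {n. \<exists>c y. encode c = n \<and> ev X c [n] y}"

definition join :: "(nat \<Rightarrow> nat set) \<Rightarrow> nat set" where
  "join A = {prod_encode (i, x) | i x. x \<in> A i}"

definition thin_for :: "nat set \<Rightarrow> (nat \<Rightarrow> nat) \<Rightarrow> bool" where
  "thin_for S f \<longleftrightarrow> (\<exists>c. \<forall>x\<in>S. f x \<noteq> c)"

definition bl_code :: "bool list \<Rightarrow> nat" where
  "bl_code s = enc_list (map (\<lambda>b. if b then 1 else 0) s)"

definition is_tree :: "bool list set \<Rightarrow> bool" where
  "is_tree T \<longleftrightarrow> (\<forall>s\<in>T. \<forall>n. take n s \<in> T)"

definition is_path :: "(nat \<Rightarrow> bool) \<Rightarrow> bool list set \<Rightarrow> bool" where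
  "is_path p T \<longleftrightarrow> (\<forall>n. map p [0..<n] \<in> T)"

definition gg :: "nat set \<Rightarrow> nat set \<Rightarrow> bool" where
  "gg A B \<longleftrightarrow> (\<forall>T. is_tree T \<and> infinite T \<and> turing_le (bl_code ` T) B
      \<longrightarrow> (\<exists>p. is_path p T \<and> turing_le {n. p n} A))"

end

theory Submission
  imports Defs "HOL-Library.More_List" "HOL-Library.Infinite_Set"
begin

text \<open>If \<open>c \<noteq> c'\<close> then \<open>f i\<close> cannot be eventually equal to both. Being constantly equal to a given
  colour from a given point on is decidable in \<open>0'\<close>, so the correct choices of colours to be avoided
  are the paths of an infinite \<open>0'\<close>-computable binary tree, and \<open>D\<close> computes a path. Relative to such
  a path, \<open>A\<close> is built by finite extensions: at stage \<open>k\<close> a colour not yet used in column \<open>k\<close> is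
  forbidden there, and \<open>0'\<close> decides whether some finite extension respecting the colours forbidden
  so far makes the \<open>k\<close>-th computation halt. Later columns are unrestricted at stage \<open>k\<close>, so a
  negative answer settles the \<open>k\<close>-th bit of the jump of \<open>A\<close> for good. For the second claim the path is
  taken from the low basis theorem relative to \<open>0'\<close>, so that the jump of its join with \<open>0'\<close> is
  computable in \<open>0''\<close>.\<close>

subsection \<open>Programs and computable functions\<close>

text \<open>Whether \<open>F k\<close> is eventually equal to a given colour is a \<Sigma>2
  question, out of reach of \<open>0'\<close>; only the weaker task of picking a safe colour out of
  two is within reach of a path. If the choices for all columns were imposed at the outset,
  admissibility of a string would depend on the whole path, and asking for an admissible halting
  extension would require the jump of that path. With finitely many forbidden colours, stored as a
  list, admissibility is computable uniformly in the list, so the question is \<Sigma>1 and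
  \<open>0'\<close> answers it. The price is that column \<open>k\<close> may already contain
  elements of finitely many colours when its turn comes. The path must therefore offer arbitrarily
  large safe colours in every column, which is why it chooses between \<open>2 * c\<close> and
  \<open>2 * c + 1\<close> for every pair \<open>(k, c)\<close> and not just once per
  column.\<close>

inductive_cases ev_ZerE: "ev X Zer xs y"
  and ev_Suc_fE: "ev X Suc_f xs y"
  and ev_ProjE: "ev X (Proj i) xs y"
  and ev_CompE: "ev X (Comp f gs) xs y"
  and ev_Prec_0E: "ev X (Prec f g) (0 # xs) y"
  and ev_Prec_SucE: "ev X (Prec f g) (Suc n # xs) y"
  and ev_MnE: "ev X (Mn f) xs y"
  and ev_OrcE: "ev X Orc xs y"

text \<open>Induction on the first evaluation. For \<open>Mn\<close>, the smaller of two different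
  results would make the body both zero and nonzero.\<close>

lemma ev_functional: "ev X c xs y \<Longrightarrow> ev X c xs z \<Longrightarrow> y = z"
proof (induction arbitrary: z rule: ev.induct)
  case (ev_comp xs gs ys f y)
  from ev_comp.prems obtain zs where zs: "list_all2 (\<lambda>g y. ev X g xs y) gs zs" "ev X f zs z"
    by (rule ev_CompE)
  have "ys = zs"
    using ev_comp.IH(1) zs(1) unfolding list_all2_conv_all_nth
    by (intro nth_equalityI) auto
  then show ?case using ev_comp.IH(2) zs(2) by simp
next
  case (ev_precS f g n xs y y')
  from ev_precS.prems obtain u where "ev X (Prec f g) (n # xs) u" "ev X g (u # n # xs) z"
    by (rule ev_Prec_SucE)
  then show ?case using ev_precS.IH by blast
next
  case (ev_mn f n xs)
  from ev_mn.prems have z: "ev X f (z # xs) 0" "\<forall>m<z. \<exists>y. ev X f (m # xs) y \<and> y \<noteq> 0"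
    by (auto elim: ev_MnE)
  show ?case
  proof (rule linorder_cases[of n z])
    assume "n < z"
    then obtain y where "ev X f (n # xs) y" "y \<noteq> 0" using z(2) by blast
    then show ?thesis using ev_mn.IH(1) by fastforce
  next
    assume "z < n"
    then obtain y where "y \<noteq> 0" "\<forall>w. ev X f (z # xs) w \<longrightarrow> y = w" using ev_mn.IH(2) by blast
    then show ?thesis using z(1) by fastforce
  qed
next
  case (ev_prec0 f xs y g)
  then show ?case by (blast elim: ev_Prec_0E)
qed (auto elim: ev_ZerE ev_Suc_fE ev_ProjE ev_OrcE)

lemma ev_proj0: "ev X (Proj 0) (x # xs) x"
  and ev_proj1: "ev X (Proj 1) (x # y # xs) y"
  and ev_proj2: "ev X (Proj 2) (x # y # z # xs) z"
  using ev_proj[of 0 "x # xs" X] ev_proj[of 1 "x # y # xs" X] ev_proj[of 2 "x # y # z # xs" X]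
  by simp_all

lemma ev_comp1: "ev X g xs y \<Longrightarrow> ev X f [y] z \<Longrightarrow> ev X (Comp f [g]) xs z"
  by (rule ev_comp) auto

lemma ev_comp2:
  "ev X g xs y \<Longrightarrow> ev X g' xs y' \<Longrightarrow> ev X f [y, y'] z \<Longrightarrow> ev X (Comp f [g, g']) xs z"
  by (rule ev_comp) auto

section \<open>Programs for basic arithmetic and Cantor pairing\<close>

primrec const_rf :: "nat \<Rightarrow> rf" where
  "const_rf 0 = Zer"
| "const_rf (Suc n) = Comp Suc_f [const_rf n]"

lemma ev_const_rf: "ev X (const_rf n) xs n"
  by (induction n) (auto intro: ev_zer ev_suc ev_comp1)

definition "add_rf = Prec (Proj 0) (Comp Suc_f [Proj 0])"
definition "pred_rf = Prec Zer (Proj 1)"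
text \<open>The subtrahend is the first argument, because \<open>Prec\<close> recurses on that
  one.\<close>

definition "monus_rf = Prec (Proj 0) (Comp pred_rf [Proj 0])"
definition "triangle_rf = Prec Zer (Comp add_rf [Comp Suc_f [Proj 1], Proj 0])"
definition "pair_rf = Comp add_rf [Comp triangle_rf [add_rf], Proj 0]"
text \<open>\<open>Suc x - triangle (Suc s)\<close> first vanishes when \<open>s\<close> is the
  diagonal of \<open>x\<close>. A Cantor code is the triangular number of its diagonal plus its
  first component, so subtraction then yields both components.\<close>

definition "diag_rf =
  Mn (Comp monus_rf [Comp triangle_rf [Comp Suc_f [Proj 0]], Comp Suc_f [Proj 1]])"
definition "fst_rf = Comp monus_rf [Comp triangle_rf [diag_rf], Proj 0]"
definition "snd_rf = Comp monus_rf [fst_rf, diag_rf]"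

lemma ev_add_rf: "ev X add_rf [m, n] (m + n)"
  unfolding add_rf_def
  by (induction m) (auto intro: ev_prec0 ev_precS ev_suc ev_comp1 ev_proj0)

lemma ev_pred_rf: "ev X pred_rf [n] (n - 1)"
  unfolding pred_rf_def
  by (induction n) (auto intro: ev_prec0 ev_precS ev_zer ev_proj1[unfolded One_nat_def])

lemma ev_monus_rf: "ev X monus_rf [n, m] (m - n)"
  unfolding monus_rf_def
proof (induction n)
  case (Suc n)
  show ?case
    by (rule ev_precS[OF Suc ev_comp1[OF ev_proj0]]) (use ev_pred_rf[of X "m - n"] in simp)
qed (auto intro: ev_prec0 ev_proj0)

lemma ev_triangle_rf: "ev X triangle_rf [n] (triangle n)"
  unfolding triangle_rf_def
proof (induction n)
  case (Suc n)
  show ?case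
    by (rule ev_precS[OF Suc ev_comp2[OF ev_comp1[OF ev_proj1 ev_suc] ev_proj0]])
      (use ev_add_rf[of X "Suc n" "triangle n"] in \<open>simp add: add.commute\<close>)
qed (auto intro: ev_prec0 ev_zer)

lemma ev_pair_rf: "ev X pair_rf [m, n] (prod_encode (m, n))"
  unfolding pair_rf_def prod_encode_def prod.case
  by (rule ev_comp2[OF ev_comp1[OF ev_add_rf ev_triangle_rf] ev_proj0 ev_add_rf])

lemma triangle_mono: "m \<le> n \<Longrightarrow> triangle m \<le> triangle n"
  by (induction rule: dec_induct) (auto simp: triangle_Suc)

lemma ev_diag_rf: "ev X diag_rf [prod_encode (m, n)] (m + n)"
  unfolding diag_rf_def
proof (rule ev_mn)
  let ?x = "prod_encode (m, n)"
  have *: "ev X (Comp monus_rf [Comp triangle_rf [Comp Suc_f [Proj 0]], Comp Suc_f [Proj 1]])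
    (s # [?x]) (Suc ?x - triangle (Suc s))" for s
    by (rule ev_comp2[OF ev_comp1[OF ev_comp1[OF ev_proj0 ev_suc] ev_triangle_rf]
          ev_comp1[OF ev_proj1 ev_suc] ev_monus_rf])
  have "Suc ?x - triangle (Suc (m + n)) = 0"
    by (simp add: prod_encode_def)
  then show "ev X (Comp monus_rf [Comp triangle_rf [Comp Suc_f [Proj 0]], Comp Suc_f [Proj 1]])
      [m + n, ?x] 0"
    using * by metis
  have "Suc ?x - triangle (Suc s) \<noteq> 0" if "s < m + n" for s
    using triangle_mono[of "Suc s" "m + n"] that by (simp add: prod_encode_def)
  then show "\<forall>s<m + n. \<exists>y. ev X (Comp monus_rf [Comp triangle_rf [Comp Suc_f [Proj 0]],
      Comp Suc_f [Proj 1]]) (s # [?x]) y \<and> y \<noteq> 0"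
    using * by blast
qed

lemma ev_fst_rf: "ev X fst_rf [prod_encode (m, n)] m"
proof -
  have "prod_encode (m, n) - triangle (m + n) = m"
    by (simp add: prod_encode_def)
  then show ?thesis
    unfolding fst_rf_def
    using ev_comp2[OF ev_comp1[OF ev_diag_rf ev_triangle_rf] ev_proj0 ev_monus_rf] by metis
qed

lemma ev_snd_rf: "ev X snd_rf [prod_encode (m, n)] n"
  unfolding snd_rf_def
  using ev_comp2[OF ev_fst_rf ev_diag_rf ev_monus_rf] by fastforce

text \<open>Encodings are bijective, so that unbounded search over \<open>nat\<close> is search over the type.\<close>

class coded =
  fixes enc :: "'a \<Rightarrow> nat"
  assumes bij_enc: "bij enc"
begin

lemma enc_eq_iff [simp]: "enc x = enc y \<longleftrightarrow> x = y"
  using bij_enc by (auto dest: bij_is_inj injD)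

lemma enc_surj: "\<exists>x. enc x = n"
  using bij_enc by (metis bij_pointE)

end

instantiation nat :: coded
begin
definition enc_nat :: "nat \<Rightarrow> nat" where [simp]: "enc_nat n = n"
instance by standard (simp add: bij_def inj_def surj_def)
end

instantiation prod :: (coded, coded) coded
begin
definition enc_prod :: "'a \<times> 'b \<Rightarrow> nat" where
  "enc_prod p = prod_encode (enc (fst p), enc (snd p))"
instance
proof
  have "\<exists>p :: 'a \<times> 'b. enc p = n" for n
    using enc_surj[of "fst (prod_decode n)"] enc_surj[of "snd (prod_decode n)"]
    by (metis enc_prod_def fst_conv prod.collapse prod_decode_inverse snd_conv)
  then show "bij (enc :: 'a \<times> 'b \<Rightarrow> nat)"
    by (auto simp: bij_def inj_def enc_prod_def prod_eq_iff surj_def) metis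
qed
end


lemma enc_Pair: "enc (x, y) = prod_encode (enc x, enc y)"
  by (simp add: enc_prod_def)

instantiation list :: (coded) coded
begin
definition list_enc: "enc xs = Defs.enc_list (map enc xs)"
instance
proof
  have "inj (enc :: 'a list \<Rightarrow> nat)"
  proof (rule injI)
    fix xs ys :: "'a list"
    assume "enc xs = enc ys"
    then show "xs = ys"
      unfolding list_enc
    proof (induction xs arbitrary: ys)
      case Nil
      then show ?case by (cases ys) auto
    next
      case (Cons x xs)
      then show ?case by (cases ys) auto
    qed
  qed
  moreover have "\<exists>xs :: 'a list. enc xs = n" for n
  proof (induction n rule: less_induct)
    case (less n)
    show ?case
    proof (cases n)
      case 0
      then show ?thesis by (intro exI[of _ "[]"]) (simp add: list_enc)
    next
      case (Suc m)
      obtain a b where ab: "m = prod_encode (a, b)"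
        by (metis prod.exhaust prod_decode_inverse)
      then have "b < n" using Suc le_prod_encode_2[of b a] by simp
      then obtain ys :: "'a list" where "enc ys = b" using less by blast
      moreover obtain x :: 'a where "enc x = a" using enc_surj by blast
      ultimately show ?thesis
        by (intro exI[of _ "x # ys"]) (simp add: list_enc ab Suc)
    qed
  qed
  ultimately show "bij (enc :: 'a list \<Rightarrow> nat)"
    by (simp add: bij_def surj_def) metis
qed
end

lemma enc_Nil: "enc [] = 0"
  and enc_Cons: "enc (x # xs) = Suc (prod_encode (enc x, enc xs))"
  by (simp_all add: list_enc)

lemma enc_nat_list: "enc (xs :: nat list) = enc_list xs"
  by (simp add: list_enc cong: map_cong)

text \<open>Lets the code of a list serve as a number of iterations that suffices to traverse
  it.\<close>

lemma length_le_enc: "length xs \<le> enc xs"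
proof (induction xs)
  case (Cons x xs)
  then show ?case using le_prod_encode_2[of "enc xs" "enc x"] by (simp add: enc_Cons)
qed simp

section \<open>Computable functions and decidable predicates on coded types\<close>

definition computable :: "nat set \<Rightarrow> ('a::coded \<Rightarrow> 'b::coded) \<Rightarrow> bool" where
  "computable X f \<longleftrightarrow> (\<exists>c. \<forall>x. ev X c [enc x] (enc (f x)))"

definition decidable :: "nat set \<Rightarrow> ('a::coded \<Rightarrow> bool) \<Rightarrow> bool" where
  "decidable X P \<longleftrightarrow> computable X (\<lambda>x. of_bool (P x) :: nat)"

lemma computableI: "(\<And>x. ev X c [enc x] (enc (f x))) \<Longrightarrow> computable X f"
  unfolding computable_def by blast

lemma computableE:
  assumes "computable X f"
  obtains c where "\<And>x. ev X c [enc x] (enc (f x))"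
  using assms unfolding computable_def by blast

named_theorems computability

lemma computable_const [computability]: "computable X (\<lambda>x. c)"
  by (rule computableI, rule ev_const_rf)

lemma computable_id [computability]: "computable X (\<lambda>x. x)"
  by (rule computableI, rule ev_proj0)

lemma computable_compose:
  assumes "computable X g" "computable X f"
  shows "computable X (\<lambda>x. g (f x))"
proof -
  obtain c where c: "ev X c [enc x] (enc (g x))" for x using assms(1) by (rule computableE) blast
  obtain d where d: "ev X d [enc x] (enc (f x))" for x using assms(2) by (rule computableE) blast
  show ?thesis by (rule computableI[of _ "Comp c [d]"]) (rule ev_comp1[OF d c])
qed

lemma computable_binop:
  fixes op :: "'b::coded \<Rightarrow> 'c::coded \<Rightarrow> 'd::coded"
  assumes c: "\<And>y z. ev X c [enc y, enc z] (enc (op y z))"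
    and "computable X f" "computable X g"
  shows "computable X (\<lambda>x. op (f x) (g x))"
proof -
  obtain d where d: "ev X d [enc x] (enc (f x))" for x using assms(2) by (rule computableE) blast
  obtain e where e: "ev X e [enc x] (enc (g x))" for x using assms(3) by (rule computableE) blast
  show ?thesis by (rule computableI[of _ "Comp c [d, e]"]) (rule ev_comp2[OF d e c])
qed

lemma computable_Pair [computability]:
  "computable X f \<Longrightarrow> computable X g \<Longrightarrow> computable X (\<lambda>x. (f x, g x))"
  by (rule computable_binop[where op = Pair and c = pair_rf])
    (auto simp: enc_Pair intro: ev_pair_rf)

lemma computable_fst [computability]: "computable X f \<Longrightarrow> computable X (\<lambda>x. fst (f x))"
  by (rule computable_compose[where g = fst], rule computableI[where c = fst_rf])
    (auto simp: enc_prod_def intro: ev_fst_rf)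

lemma computable_snd [computability]: "computable X f \<Longrightarrow> computable X (\<lambda>x. snd (f x))"
  by (rule computable_compose[where g = snd], rule computableI[where c = snd_rf])
    (auto simp: enc_prod_def intro: ev_snd_rf)

lemma computable_Suc [computability]:
  "computable X f \<Longrightarrow> computable X (\<lambda>x. Suc (f x))"
  by (rule computable_compose[where g = Suc], rule computableI[where c = Suc_f])
    (auto intro: ev_suc)

lemma computable_add [computability]:
  "computable X f \<Longrightarrow> computable X g \<Longrightarrow> computable X (\<lambda>x. f x + g x :: nat)"
  by (rule computable_binop[where op = "(+)" and c = add_rf]) (auto intro: ev_add_rf)

lemma computable_diff [computability]:
  assumes "computable X f" "computable X g"
  shows "computable X (\<lambda>x. f x - g x :: nat)"
  by (rule computable_binop[where op = "\<lambda>n m. m - n" and c = monus_rf, OF _ assms(2,1)])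
    (auto intro: ev_monus_rf)

lemma computable_rec_nat [computability]:
  fixes g :: "'a::coded \<Rightarrow> 'b::coded"
  assumes "computable X g" "computable X (\<lambda>p. h (fst p) (fst (snd p)) (snd (snd p)))"
    and "computable X k"
  shows "computable X (\<lambda>x. rec_nat (g x) (h x) (k x))"
proof -
  obtain c where c: "ev X c [enc x] (enc (g x))" for x using assms(1) by (rule computableE) blast
  obtain d where d: "ev X d [enc p] (enc (h (fst p) (fst (snd p)) (snd (snd p))))" for p
    using assms(2) by (rule computableE) blast
  obtain e where e: "ev X e [enc x] (enc (k x))" for x using assms(3) by (rule computableE) blast
  \<comment> \<open>\<open>Prec\<close> passes the previous value, the counter and the parameter in
    this order; \<open>d\<close> expects the code of the triple in the reverse order.\<close>
  define r where "r = Prec c (Comp d [Comp pair_rf [Proj 2, Comp pair_rf [Proj 1, Proj 0]]])"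
  have "ev X r [n, enc x] (enc (rec_nat (g x) (h x) n))" for n x
  proof (induction n)
    case 0
    show ?case unfolding r_def by (simp add: c ev_prec0)
  next
    case (Suc n)
    show ?case
      unfolding r_def
      by (rule ev_precS[OF Suc[unfolded r_def]], rule ev_comp1,
          rule ev_comp2[OF ev_proj2 ev_comp2[OF ev_proj1 ev_proj0 ev_pair_rf] ev_pair_rf])
        (use d[of "(x, n, rec_nat (g x) (h x) n)"] in \<open>simp add: enc_Pair\<close>)
  qed
  moreover have "ev X e [enc x] (k x)" for x using e[of x] by simp
  ultimately have "ev X (Comp r [e, Proj 0]) [enc x] (enc (rec_nat (g x) (h x) (k x)))" for x
    by (blast intro: ev_comp2 ev_proj0)
  then show ?thesis by (rule computableI)
qed

text \<open>Case distinction is primitive recursion with at most one step.\<close>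

lemma computable_If [computability]:
  assumes "decidable X P" "computable X f" "computable X g"
  shows "computable X (\<lambda>x. if P x then f x else g x)"
proof -
  have "computable X (\<lambda>x. rec_nat (g x) (\<lambda>_ _. f x) (of_bool (P x)))"
    by (rule computable_rec_nat[OF assms(3) computable_compose[OF assms(2)] assms(1)[unfolded decidable_def]])
      (rule computable_fst, rule computable_id)
  moreover have "rec_nat (g x) (\<lambda>_ _. f x) (of_bool (P x)) = (if P x then f x else g x)" for x
    by simp
  ultimately show ?thesis by simp
qed

lemma computable_of_bool [computability]:
  "decidable X P \<Longrightarrow> computable X (\<lambda>x. of_bool (P x) :: nat)"
  by (simp add: decidable_def)

lemma decidable_compose: "decidable X P \<Longrightarrow> computable X f \<Longrightarrow> decidable X (\<lambda>x. P (f x))"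
  unfolding decidable_def by (rule computable_compose)

lemma decidable_eq_0: "computable X f \<Longrightarrow> decidable X (\<lambda>x. f x = (0 :: nat))"
proof -
  assume "computable X f"
  then have "computable X (\<lambda>x. 1 - f x)" by (intro computability)
  moreover have "1 - n = of_bool (n = 0)" for n :: nat by simp
  ultimately show ?thesis unfolding decidable_def by simp
qed

lemma decidable_const [computability]: "decidable X (\<lambda>x. b)"
  unfolding decidable_def by (rule computable_const)

lemma decidable_le [computability]:
  assumes "computable X f" "computable X g"
  shows "decidable X (\<lambda>x. f x \<le> (g x :: nat))"
  using decidable_eq_0[OF computable_diff[OF assms]] by simp

lemma decidable_not [computability]:
  assumes "decidable X P"
  shows "decidable X (\<lambda>x. \<not> P x)"
proof -
  have "decidable X (\<lambda>x. of_bool (P x) = (0 :: nat))"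
    using assms by (intro decidable_eq_0) (simp add: decidable_def)
  then show ?thesis by simp
qed

lemma decidable_less [computability]:
  assumes "computable X f" "computable X g"
  shows "decidable X (\<lambda>x. f x < (g x :: nat))"
  using decidable_not[OF decidable_le[OF assms(2,1)]] by (simp add: not_le)

lemma decidable_or [computability]:
  assumes "decidable X P" "decidable X Q"
  shows "decidable X (\<lambda>x. P x \<or> Q x)"
proof -
  have "decidable X (\<lambda>x. \<not> (of_bool (P x) + of_bool (Q x) = (0 :: nat)))"
    using assms by (intro decidable_not decidable_eq_0 computability)
  then show ?thesis by simp
qed

lemma decidable_and [computability]:
  assumes "decidable X P" "decidable X Q"
  shows "decidable X (\<lambda>x. P x \<and> Q x)"
  using decidable_not[OF decidable_or[OF assms[THEN decidable_not]]] by simp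

lemma decidable_imp [computability]:
  assumes "decidable X P" "decidable X Q"
  shows "decidable X (\<lambda>x. P x \<longrightarrow> Q x)"
  unfolding imp_conv_disj by (rule decidable_or[OF decidable_not[OF assms(1)] assms(2)])

lemma computable_enc: "computable X f \<Longrightarrow> computable X (\<lambda>x. enc (f x))"
  unfolding computable_def by simp

lemma decidable_eq [computability]:
  assumes "computable X f" "computable X g"
  shows "decidable X (\<lambda>x. f x = g x)"
proof -
  have "decidable X (\<lambda>x. enc (f x) \<le> enc (g x) \<and> enc (g x) \<le> enc (f x))"
    using assms by (intro computability computable_enc)
  moreover have "enc (f x) \<le> enc (g x) \<and> enc (g x) \<le> enc (f x) \<longleftrightarrow> f x = g x" for x
    by (metis enc_eq_iff order_antisym order_refl)
  ultimately show ?thesis by simp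
qed

lemma decidable_ball_less [computability]:
  fixes k :: "'a::coded \<Rightarrow> nat"
  assumes "decidable X (\<lambda>p. P (fst p) (snd p))" "computable X k"
  shows "decidable X (\<lambda>x. \<forall>i<k x. P x i)"
proof -
  have "computable X (\<lambda>x. rec_nat 1 (\<lambda>i r. if P x i then r else 0) (k x) :: nat)"
    by (intro computability assms(2) decidable_compose[OF assms(1), of "\<lambda>p. (fst p, fst (snd p))", simplified])
  moreover have "rec_nat 1 (\<lambda>i r. if P x i then r else 0) n = (of_bool (\<forall>i<n. P x i) :: nat)" for n x
    by (induction n) (auto simp: less_Suc_eq)
  ultimately show ?thesis by (simp add: decidable_def)
qed

lemma decidable_bex_less [computability]:
  fixes k :: "'a::coded \<Rightarrow> nat"
  assumes "decidable X (\<lambda>p. P (fst p) (snd p))" "computable X k"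
  shows "decidable X (\<lambda>x. \<exists>i<k x. P x i)"
  using decidable_not[OF decidable_ball_less[OF decidable_not[OF assms(1)] assms(2)]] by simp

subsection \<open>Lists and unbounded search\<close>

definition dec :: "nat \<Rightarrow> 'a::coded" where
  "dec = inv enc"

lemma dec_enc [simp]: "dec (enc x) = x"
  unfolding dec_def by (rule inv_f_f[OF bij_is_inj[OF bij_enc]])

lemma enc_dec [simp]: "enc (dec n) = n"
  unfolding dec_def by (rule surj_f_inv_f[OF bij_is_surj[OF bij_enc]])

text \<open>Programs see only codes, so a map that merely reinterprets a code, such as
  \<open>dec\<close> or \<open>prod_decode\<close>, costs nothing.\<close>

lemma computable_enc_cong:
  "(\<And>x. enc (g x) = enc (f x)) \<Longrightarrow> computable X f \<Longrightarrow> computable X g"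
  by (simp add: computable_def)

lemma computable_dec [computability]: "computable X f \<Longrightarrow> computable X (\<lambda>x. dec (f x))"
  by (erule computable_enc_cong[rotated]) simp

lemma computable_prod_decode [computability]:
  "computable X f \<Longrightarrow> computable X (\<lambda>x. prod_decode (f x))"
  by (erule computable_enc_cong[rotated]) (simp add: enc_prod_def)

lemma computable_prod_encode [computability]:
  "computable X f \<Longrightarrow> computable X (\<lambda>x. prod_encode (f x))"
  by (erule computable_enc_cong[rotated]) (simp add: enc_prod_def)

declare computable_enc [computability]

lemma computable_Cons [computability]:
  fixes f :: "'a::coded \<Rightarrow> 'b::coded"
  shows "computable X f \<Longrightarrow> computable X g \<Longrightarrow> computable X (\<lambda>x. f x # g x)"
  by (rule computable_binop[where op = "(#)" and c = "Comp Suc_f [pair_rf]"])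
    (auto simp: enc_Cons intro: ev_comp1 ev_pair_rf ev_suc)

text \<open>The code of a nonempty list is the successor of the code of the pair of head and tail.
  The value at \<open>[]\<close> is arbitrary and is guarded by a test for emptiness.\<close>

definition uncons :: "'a::coded list \<Rightarrow> 'a \<times> 'a list" where
  "uncons l = dec (enc l - 1)"

lemma uncons_Cons [simp]: "uncons (x # xs) = (x, xs)"
proof -
  have "uncons (x # xs) = dec (enc (x, xs))"
    by (simp add: uncons_def enc_Cons enc_Pair)
  then show ?thesis by simp
qed

lemma computable_case_list [computability]:
  fixes l :: "'a::coded \<Rightarrow> 'b::coded list"
  assumes "computable X l" "computable X a"
    and f: "computable X (\<lambda>p. f (fst p) (fst (snd p)) (snd (snd p)))"
  shows "computable X (\<lambda>x. case l x of [] \<Rightarrow> a x | h # t \<Rightarrow> f x h t)"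
proof -
  have "computable X (\<lambda>x. uncons (l x))"
    unfolding uncons_def by (intro computability assms)
  then have "computable X (\<lambda>x. if l x = [] then a x
      else f x (fst (uncons (l x))) (snd (uncons (l x))))"
    using computable_compose[OF f, of "\<lambda>x. (x, uncons (l x))"]
    by (intro computability assms) (simp add: computability)
  moreover have "(if l x = [] then a x else f x (fst (uncons (l x))) (snd (uncons (l x)))) =
      (case l x of [] \<Rightarrow> a x | h # t \<Rightarrow> f x h t)" for x
    by (cases "l x") auto
  ultimately show ?thesis by simp
qed

text \<open>Primitive recursion on the state of accumulator and remaining list. A state with an
  exhausted list is a fixed point, so running for \<open>enc (l x)\<close> steps overshoots
  harmlessly.\<close>

lemma computable_fold [computability]:
  fixes l :: "'a::coded \<Rightarrow> 'b::coded list" and a :: "'a \<Rightarrow> 'c::coded"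
  assumes g: "computable X (\<lambda>p. g (fst p) (fst (snd p)) (snd (snd p)))"
    and "computable X l" "computable X a"
  shows "computable X (\<lambda>x. fold (g x) (l x) (a x))"
proof -
  define s where
    "s x r = (case snd r of [] \<Rightarrow> r | h # t \<Rightarrow> (g x h (fst r), t))" for x and r :: "'c \<times> 'b list"
  have "computable X (\<lambda>p. s (fst p) (snd (snd p)))"
    unfolding s_def
    by (intro computability
        computable_compose[OF g, of "\<lambda>p. (fst (fst p), fst (snd p), fst (snd (snd (fst p))))", simplified])
  then have "computable X (\<lambda>x. fst (rec_nat (a x, l x) (\<lambda>_. s x) (enc (l x))))"
    by (intro computability assms)
  moreover have "fst (rec_nat (a x, l x) (\<lambda>_. s x) (enc (l x))) = fold (g x) (l x) (a x)" for x
  proof -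
    \<comment> \<open>\<open>rec_nat\<close> unfolds its last step, whereas \<open>fold\<close>
      consumes the first element, so a step has to be moved to the start.\<close>
    have shift: "rec_nat r (\<lambda>_. s x) (Suc n) = rec_nat (s x r) (\<lambda>_. s x) n" for r n
      by (induction n) auto
    have "rec_nat (b, xs) (\<lambda>_. s x) n = (fold (g x) xs b, [])" if "length xs \<le> n" for b xs n
      using that
    proof (induction n arbitrary: b xs)
      case (Suc n)
      show ?case
      proof (cases xs)
        case Nil
        have "s x (b, []) = (b, [])" by (simp add: s_def)
        then show ?thesis unfolding shift Nil using Suc.IH[of "[]" b] by simp
      next
        case (Cons h t)
        then have "rec_nat (g x h b, t) (\<lambda>_. s x) n = (fold (g x) t (g x h b), [])"
          using Suc by simp
        moreover have "s x (b, h # t) = (g x h b, t)" by (simp add: s_def)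
        ultimately show ?thesis unfolding shift Cons by simp
      qed
    qed simp
    then show ?thesis by (simp add: length_le_enc)
  qed
  ultimately show ?thesis by simp
qed

lemma computable_rev [computability]:
  fixes f :: "'a::coded \<Rightarrow> 'b::coded list"
  assumes "computable X f"
  shows "computable X (\<lambda>x. rev (f x))"
proof -
  have "computable X (\<lambda>x. fold (#) (f x) [])"
    by (intro computability assms)
  then show ?thesis by (simp add: fold_Cons_rev)
qed

lemma computable_append [computability]:
  fixes f :: "'a::coded \<Rightarrow> 'b::coded list"
  assumes "computable X f" "computable X g"
  shows "computable X (\<lambda>x. f x @ g x)"
proof -
  have "computable X (\<lambda>x. fold (#) (rev (f x)) (g x))"
    by (intro computability assms)
  then show ?thesis by (simp add: fold_Cons_rev)
qed

lemma computable_map [computability]: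
  fixes f :: "'a::coded \<Rightarrow> 'b::coded list" and g :: "'a \<Rightarrow> 'b \<Rightarrow> 'c::coded"
  assumes g: "computable X (\<lambda>p. g (fst p) (snd p))" and "computable X f"
  shows "computable X (\<lambda>x. map (g x) (f x))"
proof -
  have "computable X (\<lambda>x. fold (\<lambda>y r. r @ [g x y]) (f x) [])"
    by (intro computability assms
        computable_compose[OF g, of "\<lambda>p. (fst p, fst (snd p))", simplified])
  moreover have "fold (\<lambda>y r. r @ [h y]) ys b = b @ map h ys" for h :: "'b \<Rightarrow> 'c" and ys b
    by (induction ys arbitrary: b) auto
  ultimately show ?thesis by simp
qed

lemma computable_length [computability]:
  fixes f :: "'a::coded \<Rightarrow> 'b::coded list"
  assumes "computable X f"
  shows "computable X (\<lambda>x. length (f x))"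
proof -
  have "computable X (\<lambda>x. fold (\<lambda>_ n. Suc n) (f x) 0)"
    by (intro computability assms)
  moreover have "fold (\<lambda>_ n. Suc n) ys b = b + length ys" for ys :: "'b list" and b
    by (induction ys arbitrary: b) auto
  ultimately show ?thesis by simp
qed

lemma computable_hd [computability]:
  fixes f :: "'a::coded \<Rightarrow> 'b::coded list"
  assumes "computable X f"
  shows "computable X (\<lambda>x. hd (f x))"
  unfolding hd_def by (intro computability assms)

lemma computable_tl [computability]:
  fixes f :: "'a::coded \<Rightarrow> 'b::coded list"
  assumes "computable X f"
  shows "computable X (\<lambda>x. tl (f x))"
  unfolding tl_def by (intro computability assms)

lemma computable_drop [computability]:
  fixes f :: "'a::coded \<Rightarrow> 'b::coded list"
  assumes "computable X k" "computable X f"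
  shows "computable X (\<lambda>x. drop (k x) (f x))"
proof -
  have "computable X (\<lambda>x. rec_nat (f x) (\<lambda>_ r. tl r) (k x))"
    by (intro computability assms)
  moreover have "rec_nat l (\<lambda>_ r. tl r) n = drop n l" for l :: "'b list" and n
    by (induction n) (auto simp: drop_Suc tl_drop)
  ultimately show ?thesis by simp
qed

lemma computable_nth_default [computability]:
  fixes f :: "'a::coded \<Rightarrow> 'b::coded list"
  assumes "computable X f" "computable X k"
  shows "computable X (\<lambda>x. nth_default d (f x) (k x))"
proof -
  have "computable X (\<lambda>x. if k x < length (f x) then hd (drop (k x) (f x)) else d)"
    by (intro computability assms)
  moreover have "(if n < length l then hd (drop n l) else d) = nth_default d l n" for l n
    by (simp add: nth_default_def hd_drop_conv_nth)
  ultimately show ?thesis by simp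
qed

lemma computable_upt [computability]:
  assumes "computable X f" "computable X g"
  shows "computable X (\<lambda>x. [f x..<g x])"
proof -
  have "computable X (\<lambda>x. rec_nat [] (\<lambda>i r. if i < f x then r else r @ [i]) (g x))"
    by (intro computability assms computable_compose[OF assms(1), of fst])
  moreover have "rec_nat [] (\<lambda>i r. if i < m then r else r @ [i]) n = [m..<n]" for m n
    by (induction n) auto
  ultimately show ?thesis by simp
qed

lemma decidable_ball_set [computability]:
  fixes l :: "'a::coded \<Rightarrow> 'b::coded list"
  assumes P: "decidable X (\<lambda>p. P (fst p) (snd p))" and "computable X l"
  shows "decidable X (\<lambda>x. \<forall>y\<in>set (l x). P x y)"
proof -
  have "computable X (\<lambda>x. fold (\<lambda>y r. if P x y then r else 0) (l x) 1 :: nat)"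
    by (intro computability assms
        decidable_compose[OF P, of "\<lambda>p. (fst p, fst (snd p))", simplified])
  moreover have "fold (\<lambda>y r. if Q y then r else 0) ys b = (if \<forall>y\<in>set ys. Q y then b else (0 :: nat))"
    for Q and ys :: "'b list" and b
    by (induction ys arbitrary: b) auto
  ultimately show ?thesis by (simp add: decidable_def of_bool_def del: One_nat_def)
qed

lemma decidable_bex_set [computability]:
  fixes l :: "'a::coded \<Rightarrow> 'b::coded list"
  assumes "decidable X (\<lambda>p. P (fst p) (snd p))" and "computable X l"
  shows "decidable X (\<lambda>x. \<exists>y\<in>set (l x). P x y)"
  using decidable_not[OF decidable_ball_set[OF decidable_not[OF assms(1)] assms(2)]] by simp

lemma decidable_mem [computability]:
  fixes l :: "'a::coded \<Rightarrow> 'b::coded list"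
  assumes "computable X f" "computable X l"
  shows "decidable X (\<lambda>x. f x \<in> set (l x))"
proof -
  have "decidable X (\<lambda>x. \<exists>y\<in>set (l x). y = f x)"
    by (intro computability assms computable_compose[OF assms(1), of fst])
  then show ?thesis by simp
qed

text \<open>Minimization over codes of candidates. The converse, that halting implies a witness, is
  what later turns existential statements into questions to the jump.\<close>

lemma search_program:
  fixes R :: "'a::coded \<Rightarrow> 'b::coded \<Rightarrow> bool"
  assumes "decidable X (\<lambda>p. R (fst p) (snd p))"
  shows "\<exists>c. \<forall>x. ((\<exists>y. R x y) \<longrightarrow> (\<exists>y. R x y \<and> ev X c [enc x] (enc y))) \<and>
    ((\<exists>z. ev X c [enc x] z) \<longrightarrow> (\<exists>y. R x y))"
proof -
  have "computable X (\<lambda>p. of_bool (\<not> R (fst p) (snd p)) :: nat)"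
    by (intro computability assms)
  then obtain r where r: "\<And>p. ev X r [enc p] (of_bool (\<not> R (fst p) (snd p)))"
    by (rule computableE) (simp, blast)
  define d where "d = Comp r [Comp pair_rf [Proj 1, Proj 0]]"
  have d: "ev X d [n, enc x] (of_bool (\<not> R x (dec n)))" for n x
    unfolding d_def using r[of "(x, dec n)"]
    by (intro ev_comp1[OF ev_comp2[OF ev_proj1 ev_proj0 ev_pair_rf]]) (simp add: enc_Pair)
  show ?thesis
  proof (intro exI[of _ "Mn d"] allI conjI impI)
    fix x
    assume "\<exists>y. R x y"
    then have ex: "\<exists>n. R x (dec n)" by (metis dec_enc)
    define n where "n = (LEAST n. R x (dec n))"
    have n: "R x (dec n)" unfolding n_def using ex by (rule LeastI_ex)
    have "ev X d [m, enc x] 1" if "m < n" for m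
      using d[of m x] not_less_Least[OF that[unfolded n_def]] by simp
    then have "ev X (Mn d) [enc x] n"
      using d[of n x] n by (intro ev_mn) (simp, metis zero_neq_one)
    then show "\<exists>y. R x y \<and> ev X (Mn d) [enc x] (enc y)"
      using n by (intro exI[of _ "dec n"]) simp
  next
    fix x :: 'a
    assume "\<exists>z. ev X (Mn d) [enc x] z"
    then obtain z where "ev X (Mn d) [enc x] z" ..
    then have "ev X d (z # [enc x]) 0" by (auto elim: ev_MnE)
    then have "R x (dec z)" using d[of z x] ev_functional by fastforce
    then show "\<exists>y. R x y" ..
  qed
qed

text \<open>The search for a successor is guaranteed to halt only on states satisfying the
  invariant, so primitive recursion with a total step function does not apply. The sequence is
  chosen together with the fact that one fixed program computes it.\<close>

lemma computable_dependent_choice: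
  fixes R :: "nat \<Rightarrow> 's::coded \<Rightarrow> 's \<Rightarrow> bool"
  assumes R: "decidable X (\<lambda>p. R (fst (fst p)) (snd (fst p)) (snd p))"
    and init: "I 0 s"
    and step: "\<And>k s. I k s \<Longrightarrow> \<exists>t. R k s t"
    and inv: "\<And>k s t. I k s \<Longrightarrow> R k s t \<Longrightarrow> I (Suc k) t"
  obtains S where "computable X S" "S 0 = s" "\<And>k. I k (S k)" "\<And>k. R k (S k) (S (Suc k))"
proof -
  obtain c where c: "\<And>p. \<exists>t. R (fst p) (snd p) t \<Longrightarrow>
      \<exists>t. R (fst p) (snd p) t \<and> ev X c [enc p] (enc t)"
    using search_program[where R = "\<lambda>p. R (fst p) (snd p)", OF R] by blast
  define d where "d = Prec (const_rf (enc s)) (Comp c [Comp pair_rf [Proj 1, Proj 0]])"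
  have "\<exists>f. \<forall>n. (I n (f n) \<and> ev X d [n] (enc (f n)) \<and> (n = 0 \<longrightarrow> f n = s)) \<and> R n (f n) (f (Suc n))"
  proof (rule dependent_nat_choice)
    show "\<exists>t. I 0 t \<and> ev X d [0] (enc t) \<and> (0 = (0::nat) \<longrightarrow> t = s)"
      unfolding d_def using init by (auto intro: ev_prec0 ev_const_rf)
  next
    fix t n
    assume t: "I n t \<and> ev X d [n] (enc t) \<and> (n = 0 \<longrightarrow> t = s)"
    then obtain u where u: "R n t u" "ev X c [enc (n, t)] (enc u)"
      using c[of "(n, t)"] step by auto
    have "ev X d [Suc n] (enc u)"
      unfolding d_def
      by (rule ev_precS[OF _ ev_comp1[OF ev_comp2[OF ev_proj1 ev_proj0 ev_pair_rf]]])
        (use t u(2) in \<open>simp_all add: d_def enc_Pair\<close>)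
    then show "\<exists>u. (I (Suc n) u \<and> ev X d [Suc n] (enc u) \<and> (Suc n = 0 \<longrightarrow> u = s)) \<and> R n t u"
      using t u inv by blast
  qed
  then obtain S where "\<And>n. I n (S n) \<and> ev X d [n] (enc (S n)) \<and> (n = 0 \<longrightarrow> S n = s)"
    "\<And>n. R n (S n) (S (Suc n))" by blast
  then show ?thesis by (intro that[of S]) (auto simp: computable_def)
qed

subsection \<open>Oracles, certificates of computations and the jump\<close>

lemma chi_eq_of_bool: "chi A n = of_bool (n \<in> A)"
  by (simp add: chi_def)

lemma turing_le_iff_decidable: "turing_le A B \<longleftrightarrow> decidable B (\<lambda>n. n \<in> A)"
  by (simp add: turing_le_def decidable_def computable_def chi_eq_of_bool)

lemma computable_chi_oracle [computability]:
  "computable X f \<Longrightarrow> computable X (\<lambda>x. chi X (f x))"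
  by (rule computable_compose[where g = "chi X"], rule computableI[where c = Orc])
    (use ev_orc[of X _ "[]"] in \<open>simp_all add: chi_def\<close>)

lemma decidable_oracle [computability]:
  "computable X f \<Longrightarrow> decidable X (\<lambda>x. f x \<in> X)"
  using computable_chi_oracle[of X f] by (simp add: decidable_def chi_eq_of_bool)

text \<open>\<open>Orc\<close> ignores all arguments but the first, while \<open>c\<close> is only
  specified on one-element lists; \<open>Proj 0\<close> discards the rest.\<close>

primrec subst_oracle :: "rf \<Rightarrow> rf \<Rightarrow> rf" where
  "subst_oracle c Zer = Zer"
| "subst_oracle c Suc_f = Suc_f"
| "subst_oracle c (Proj i) = Proj i"
| "subst_oracle c (Comp f gs) = Comp (subst_oracle c f) (map (subst_oracle c) gs)"
| "subst_oracle c (Prec f g) = Prec (subst_oracle c f) (subst_oracle c g)"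
| "subst_oracle c (Mn f) = Mn (subst_oracle c f)"
| "subst_oracle c Orc = Comp c [Proj 0]"

lemma ev_subst_oracle:
  assumes c: "\<And>n. ev Y c [n] (chi X n)" and "ev X d xs y"
  shows "ev Y (subst_oracle c d) xs y"
  using assms(2)
proof (induction rule: ev.induct)
  case (ev_comp xs gs ys f z)
  then show ?case
    by (auto simp: list_all2_conv_all_nth intro!: ev.ev_comp[of _ _ _ ys])
next
  case (ev_orc x xs)
  then show ?case
    using c[of x] by (auto simp: chi_def intro: ev_comp1[OF ev_proj0])
next
  case (ev_mn f n xs)
  then show ?case by (auto intro!: ev.ev_mn)
qed (auto intro: ev.intros)

lemma computable_relativize:
  assumes "turing_le X Y" "computable X f"
  shows "computable Y f"
  using assms ev_subst_oracle unfolding turing_le_def computable_def by blast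

lemma decidable_relativize: "turing_le X Y \<Longrightarrow> decidable X P \<Longrightarrow> decidable Y P"
  unfolding decidable_def by (rule computable_relativize)

lemma turing_le_refl: "turing_le X X"
  unfolding turing_le_iff_decidable by (intro computability)

lemma turing_le_trans: "turing_le X Y \<Longrightarrow> turing_le Y Z \<Longrightarrow> turing_le X Z"
  using decidable_relativize unfolding turing_le_iff_decidable by blast

lemma turing_le_empty: "turing_le {} X"
  unfolding turing_le_iff_decidable by (simp add: decidable_const)

lemma decidable_in: "turing_le Y X \<Longrightarrow> computable X f \<Longrightarrow> decidable X (\<lambda>x. f x \<in> Y)"
  unfolding turing_le_iff_decidable by (rule decidable_compose)

section \<open>Finite derivations as certificates\<close>

fun derivation :: "('e list \<Rightarrow> 'e \<Rightarrow> bool) \<Rightarrow> 'e list \<Rightarrow> bool" where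
  "derivation S [] \<longleftrightarrow> True"
| "derivation S (e # L) \<longleftrightarrow> S L e \<and> derivation S L"

definition derivable :: "('e list \<Rightarrow> 'e \<Rightarrow> bool) \<Rightarrow> 'e \<Rightarrow> bool" where
  "derivable S e \<longleftrightarrow> (\<exists>L. derivation S L \<and> e \<in> set L)"

text \<open>Replaces the recursion by a bounded quantifier, for which decidability is at hand. Each
  entry is justified by the entries behind it.\<close>

lemma derivation_conv_drop:
  "derivation S L \<longleftrightarrow> (\<forall>i<length L. S (tl (drop i L)) (hd (drop i L)))"
proof (induction L)
  case (Cons e L)
  then show ?case by (simp add: All_less_Suc2)
qed simp

lemma decidable_derivation [computability]:
  fixes l :: "'a::coded \<Rightarrow> 'e::coded list"
  assumes S: "decidable X (\<lambda>p. S (fst p) (fst (snd p)) (snd (snd p)))" and "computable X l"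
  shows "decidable X (\<lambda>x. derivation (S x) (l x))"
  unfolding derivation_conv_drop
  by (intro computability assms computable_compose[OF assms(2), of fst]
      decidable_compose[OF S, of "\<lambda>p. (fst p, tl (drop (snd p) (l (fst p))), hd (drop (snd p) (l (fst p))))",
        simplified])

definition step_mono :: "('e list \<Rightarrow> 'e \<Rightarrow> bool) \<Rightarrow> bool" where
  "step_mono S \<longleftrightarrow> (\<forall>L L' e. S L e \<longrightarrow> set L \<subseteq> set L' \<longrightarrow> S L' e)"

lemma derivation_append:
  assumes "step_mono S"
  shows "derivation S L \<Longrightarrow> derivation S L' \<Longrightarrow> derivation S (L @ L')"
  using assms unfolding step_mono_def by (induction L) (simp_all, metis Un_upper1 set_append)

lemma derivable_all_finite:
  assumes S: "step_mono S" and "finite E" and "\<And>e. e \<in> E \<Longrightarrow> derivable S e"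
  shows "\<exists>L. derivation S L \<and> E \<subseteq> set L"
  using assms(2,3)
proof (induction E)
  case (insert e E)
  then obtain L L' where "derivation S L" "E \<subseteq> set L" "derivation S L'" "e \<in> set L'"
    unfolding derivable_def by blast
  then show ?case using derivation_append[OF S, of L L'] by (intro exI[of _ "L @ L'"]) auto
qed (auto intro: exI[of _ "[]"])

text \<open>Monotonicity allows the certificates of finitely many premises to be concatenated; the
  conclusion is then put in front.\<close>

lemma derivableI:
  assumes "step_mono S" "finite E" "\<And>e. e \<in> E \<Longrightarrow> derivable S e"
    and "\<And>L. E \<subseteq> set L \<Longrightarrow> S L e"
  shows "derivable S e"
proof -
  obtain L where "derivation S L" "E \<subseteq> set L" using derivable_all_finite assms(1-3) by metis
  then show ?thesis
    using assms(4) unfolding derivable_def by (intro exI[of _ "e # L"]) simp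
qed

text \<open>The clauses follow the tags 0 to 6 of \<open>encode\<close>. Derivations make being a
  code of a program an existential statement, decidable in any jump, without recursion on
  codes.\<close>

definition code_step :: "nat list \<Rightarrow> nat \<Rightarrow> bool" where
  "code_step L n \<longleftrightarrow>
    (let t = fst (prod_decode n); r = snd (prod_decode n);
         a = fst (prod_decode r); b = snd (prod_decode r)
     in t \<in> {0, 1, 6} \<and> r = 0 \<or> t = 2 \<or>
        t = 3 \<and> a \<in> set L \<and> (\<forall>g\<in>set (dec b). g \<in> set L) \<or>
        t = 4 \<and> a \<in> set L \<and> b \<in> set L \<or>
        t = 5 \<and> r \<in> set L)"

lemma decidable_code_step [computability]:
  assumes "computable X f" "computable X g"
  shows "decidable X (\<lambda>x. code_step (f x) (g x))"
proof -
  have "decidable X (\<lambda>p. code_step (fst p) (snd p))"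
    unfolding code_step_def Let_def by (simp, intro computability)
  from decidable_compose[OF this computable_Pair[OF assms]] show ?thesis by simp
qed

lemma step_mono_code_step: "step_mono code_step"
  unfolding step_mono_def code_step_def Let_def by blast

lemma dec_enc_list [simp]: "dec (enc_list xs) = xs"
  using dec_enc[of xs] by (simp add: enc_nat_list)

lemma enc_list_dec [simp]: "enc_list (dec n) = n"
  using enc_dec[of n, where 'a = "nat list"] by (simp add: enc_nat_list)

lemma code_step_encode:
  "code_step L (encode (Comp f gs)) \<longleftrightarrow> encode f \<in> set L \<and> encode ` set gs \<subseteq> set L"
  "code_step L (encode (Prec f g)) \<longleftrightarrow> encode f \<in> set L \<and> encode g \<in> set L"
  "code_step L (encode (Mn f)) \<longleftrightarrow> encode f \<in> set L"
  by (auto simp: code_step_def)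

lemma derivable_encode: "derivable code_step (encode c)"
proof (induction c)
  case (Comp f gs)
  show ?case
    by (rule derivableI[OF step_mono_code_step, of "insert (encode f) (encode ` set gs)"])
      (use Comp in \<open>auto simp only: code_step_encode finite_insert finite_imageI finite_set\<close>)
next
  case (Prec f g)
  show ?case
    by (rule derivableI[OF step_mono_code_step, of "{encode f, encode g}"])
      (use Prec in \<open>auto simp only: code_step_encode finite_insert finite.emptyI\<close>)
next
  case (Mn f)
  show ?case
    by (rule derivableI[OF step_mono_code_step, of "{encode f}"])
      (use Mn in \<open>auto simp only: code_step_encode finite_insert finite.emptyI\<close>)
qed (rule derivableI[OF step_mono_code_step, of "{}"]; simp add: code_step_def)+

lemma derivation_code_step_encode:
  "derivation code_step L \<Longrightarrow> n \<in> set L \<Longrightarrow> \<exists>c. encode c = n"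
proof (induction L arbitrary: n)
  case (Cons e L)
  obtain t r where tr: "prod_decode e = (t, r)" by fastforce
  obtain a b where ab: "prod_decode r = (a, b)" by fastforce
  have e: "e = prod_encode (t, r)" "r = prod_encode (a, b)"
    using tr ab by (metis prod_decode_inverse)+
  have "code_step L e" using Cons.prems by simp
  then consider "t = 0" "r = 0" | "t = 1" "r = 0" | "t = 6" "r = 0" | "t = 2"
    | "t = 3" "a \<in> set L" "\<forall>g\<in>set (dec b). g \<in> set L"
    | "t = 4" "a \<in> set L" "b \<in> set L" | "t = 5" "r \<in> set L"
    unfolding code_step_def Let_def tr ab fst_conv snd_conv by blast
  then have "\<exists>c. encode c = e"
  proof cases
    case 5
    then obtain f where f: "encode f = a" using Cons by auto
    have "\<forall>g\<in>set (dec b). \<exists>c. encode c = g" using 5 Cons by auto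
    then obtain h where "\<forall>g\<in>set (dec b). encode (h g) = g" by metis
    then have "map encode (map h (dec b)) = dec b" by (simp add: map_idI)
    then have "encode (Comp f (map h (dec b))) = e" using f by (simp add: e 5 del: map_map)
    then show ?thesis ..
  next
    case 6
    then obtain f g where "encode f = a" "encode g = b" using Cons by (metis derivation.simps(2))
    then have "encode (Prec f g) = e" by (simp add: e 6)
    then show ?thesis ..
  next
    case 7
    then obtain f where "encode f = r" using Cons by (metis derivation.simps(2))
    then have "encode (Mn f) = e" by (simp add: e(1) 7)
    then show ?thesis ..
  next
    case 4
    then show ?thesis using e(1) by (metis encode.simps(3))
  qed (use e(1) in \<open>metis encode.simps\<close>)+
  then show ?case using Cons by auto
qed simp

text \<open>\<open>jump\<close> speaks of some program with a given code; injectivity ensures that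
  it is the intended one.\<close>

lemma inj_encode: "encode c = encode d \<Longrightarrow> c = d"
proof (induction c arbitrary: d)
  case (Comp f gs)
  then obtain f' gs' where d: "d = Comp f' gs'" by (cases d) auto
  with Comp.prems have "encode f = encode f'" "map encode gs = map encode gs'"
    by (auto dest: arg_cong[of _ _ "dec :: nat \<Rightarrow> nat list"])
  then show ?case
    using Comp.IH d by (auto intro!: nth_equalityI dest: map_eq_imp_length_eq)
      (metis length_map nth_map nth_mem)
next
  case (Prec f g)
  then show ?case by (cases d) auto
next
  case (Mn f)
  then show ?case by (cases d) auto
qed (case_tac d; auto)+

text \<open>A configuration \<open>(n, xs, y)\<close> says that the program with code \<open>n\<close> returns \<open>y\<close> on \<open>xs\<close>;
  \<open>Q x y\<close> says that the oracle answers \<open>y\<close> on the query \<open>x\<close>. Since \<open>Prec f g\<close> ignores \<open>g\<close> on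
  argument 0, a derivable configuration need not contain the code of a program.\<close>

definition ev_step ::
    "(nat \<Rightarrow> nat \<Rightarrow> bool) \<Rightarrow> (nat \<times> nat list \<times> nat) list \<Rightarrow> nat \<times> nat list \<times> nat \<Rightarrow> bool" where
  "ev_step Q L e \<longleftrightarrow>
    (let n = fst e; xs = fst (snd e); y = snd (snd e);
         t = fst (prod_decode n); r = snd (prod_decode n);
         a = fst (prod_decode r); b = snd (prod_decode r); gs = dec b :: nat list
     in t = 0 \<and> r = 0 \<and> y = 0 \<or>
        t = 1 \<and> r = 0 \<and> xs \<noteq> [] \<and> y = Suc (hd xs) \<or>
        t = 2 \<and> r < length xs \<and> y = nth_default 0 xs r \<or>
        t = 3 \<and> (\<exists>d\<in>set L. fst d = a \<and> snd (snd d) = y \<and> length (fst (snd d)) = length gs \<and>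
          (\<forall>i<length gs. (nth_default 0 gs i, xs, nth_default 0 (fst (snd d)) i) \<in> set L)) \<or>
        t = 4 \<and> xs \<noteq> [] \<and> hd xs = 0 \<and> (a, tl xs, y) \<in> set L \<or>
        t = 4 \<and> xs \<noteq> [] \<and> hd xs \<noteq> 0 \<and>
          (\<exists>d\<in>set L. fst d = n \<and> fst (snd d) = (hd xs - 1) # tl xs \<and>
            (b, snd (snd d) # (hd xs - 1) # tl xs, y) \<in> set L) \<or>
        t = 5 \<and> (r, y # xs, 0) \<in> set L \<and>
          (\<forall>m<y. \<exists>d\<in>set L. fst d = r \<and> fst (snd d) = m # xs \<and> snd (snd d) \<noteq> 0) \<or>
        t = 6 \<and> r = 0 \<and> xs \<noteq> [] \<and> Q (hd xs) y)"

text \<open>The oracles are compared only at the single query that \<open>e\<close> can make. This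
  local form is what bounds the use of a computation.\<close>

lemma ev_step_mono:
  assumes "ev_step Q L e" and Q: "Q (hd (fst (snd e))) (snd (snd e)) \<Longrightarrow> Q' (hd (fst (snd e))) (snd (snd e))"
    and "set L \<subseteq> set L'"
  shows "ev_step Q' L' e"
proof -
  have L: "d \<in> set L'" if "d \<in> set L" for d using that assms(3) by blast
  show ?thesis
    using assms(1) unfolding ev_step_def Let_def
  proof (elim disj_forward)
  qed (elim conj_forward bexE, (assumption | blast intro: Q L)+)+
qed

lemma step_mono_ev_step: "step_mono (ev_step Q)"
  unfolding step_mono_def using ev_step_mono by blast

lemma ev_step_mono_oracle:
  "ev_step Q L e \<Longrightarrow> (\<And>x y. Q x y \<Longrightarrow> Q' x y) \<Longrightarrow> ev_step Q' L e"
  by (erule ev_step_mono) auto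

lemma ev_step_Comp:
  "ev_step Q L (encode (Comp f gs), xs, y) \<longleftrightarrow>
    (\<exists>ys. (encode f, ys, y) \<in> set L \<and> length ys = length gs \<and>
      (\<forall>i<length gs. (encode (gs ! i), xs, ys ! i) \<in> set L))"
proof -
  have "ev_step Q L (encode (Comp f gs), xs, y) \<longleftrightarrow>
    (\<exists>d\<in>set L. fst d = encode f \<and> snd (snd d) = y \<and> length (fst (snd d)) = length gs \<and>
      (\<forall>i<length gs. (nth_default 0 (map encode gs) i, xs, nth_default 0 (fst (snd d)) i) \<in> set L))"
    unfolding ev_step_def Let_def by simp
  also have "\<dots> \<longleftrightarrow> (\<exists>ys. (encode f, ys, y) \<in> set L \<and> length ys = length gs \<and>
      (\<forall>i<length gs. (nth_default 0 (map encode gs) i, xs, nth_default 0 ys i) \<in> set L))"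
    (is "(\<exists>d\<in>_. _ \<and> _ \<and> _ \<and> ?P (fst (snd d))) \<longleftrightarrow> _")
    by (metis (no_types, lifting) fst_conv prod.collapse snd_conv)
  also have "\<dots> \<longleftrightarrow> (\<exists>ys. (encode f, ys, y) \<in> set L \<and> length ys = length gs \<and>
      (\<forall>i<length gs. (encode (gs ! i), xs, ys ! i) \<in> set L))"
    by (rule arg_cong[where f = Ex], rule ext, rule conj_cong[OF refl], rule conj_cong[OF refl])
      (simp add: nth_default_def)
  finally show ?thesis .
qed

lemma ev_step_Mn:
  "ev_step Q L (encode (Mn f), xs, y) \<longleftrightarrow>
    (encode f, y # xs, 0) \<in> set L \<and> (\<forall>m<y. \<exists>u. (encode f, m # xs, u) \<in> set L \<and> u \<noteq> 0)"
  unfolding ev_step_def Let_def by (simp add: Bex_def)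

lemma ev_step_Prec_0:
  "ev_step Q L (encode (Prec f g), 0 # xs, y) \<longleftrightarrow> (encode f, xs, y) \<in> set L"
  unfolding ev_step_def Let_def by simp

lemma ev_step_Prec_Suc:
  "ev_step Q L (encode (Prec f g), Suc n # xs, y) \<longleftrightarrow>
    (\<exists>u. (encode (Prec f g), n # xs, u) \<in> set L \<and> (encode g, u # n # xs, y) \<in> set L)"
  unfolding ev_step_def Let_def by (simp add: Bex_def)

lemma ev_step_Prec_Nil: "\<not> ev_step Q L (encode (Prec f g), [], y)"
  unfolding ev_step_def Let_def by simp

lemmas ev_step_encode =
  ev_step_Comp ev_step_Mn ev_step_Prec_0 ev_step_Prec_Suc ev_step_Prec_Nil

lemma derivation_ev_step_mono_oracle:
  "derivation (ev_step Q) L \<Longrightarrow> (\<And>x y. Q x y \<Longrightarrow> Q' x y) \<Longrightarrow> derivation (ev_step Q') L"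
  by (induction L) (auto intro: ev_step_mono_oracle)

abbreviation oracle_answer :: "nat set \<Rightarrow> nat \<Rightarrow> nat \<Rightarrow> bool" where
  "oracle_answer X x y \<equiv> y = chi X x"

lemma ev_derivable:
  "ev X c xs y \<Longrightarrow> derivable (ev_step (oracle_answer X)) (encode c, xs, y)"
proof (induction rule: ev.induct)
  case (ev_comp xs gs ys f z)
  then have len: "length ys = length gs" by (simp add: list_all2_lengthD)
  show ?case
  proof (rule derivableI[OF step_mono_ev_step])
    let ?E = "insert (encode f, ys, z) ((\<lambda>i. (encode (gs ! i), xs, ys ! i)) ` {..<length gs})"
    show "finite ?E" by simp
    show "derivable (ev_step (oracle_answer X)) e" if "e \<in> ?E" for e
      using that ev_comp.IH by (auto simp: list_all2_conv_all_nth)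
    show "ev_step (oracle_answer X) L (encode (Comp f gs), xs, z)" if "?E \<subseteq> set L" for L
      unfolding ev_step_Comp using that len by (intro exI[of _ ys] conjI allI impI) auto
  qed
next
  case (ev_prec0 f xs y g)
  show ?case
    by (rule derivableI[OF step_mono_ev_step, of "{(encode f, xs, y)}"])
      (use ev_prec0 in \<open>auto simp: ev_step_encode simp del: encode.simps\<close>)
next
  case (ev_precS f g n xs y z)
  show ?case
    by (rule derivableI[OF step_mono_ev_step,
          of "{(encode (Prec f g), n # xs, y), (encode g, y # n # xs, z)}"])
      (use ev_precS in \<open>auto simp: ev_step_encode simp del: encode.simps\<close>)
next
  case (ev_mn f n xs)
  then obtain h where h: "\<And>m. m < n \<Longrightarrow>
      derivable (ev_step (oracle_answer X)) (encode f, m # xs, h m) \<and> h m \<noteq> 0"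
    by metis
  show ?case
  proof (rule derivableI[OF step_mono_ev_step])
    let ?E = "insert (encode f, n # xs, 0) ((\<lambda>m. (encode f, m # xs, h m)) ` {..<n})"
    show "finite ?E" by simp
    show "derivable (ev_step (oracle_answer X)) e" if "e \<in> ?E" for e
      using that ev_mn.IH(1) h by auto
    show "ev_step (oracle_answer X) L (encode (Mn f), xs, n)" if "?E \<subseteq> set L" for L
      using that h unfolding ev_step_Mn by auto
  qed
qed (rule derivableI[OF step_mono_ev_step, of "{}"], simp, simp,
    simp add: ev_step_def nth_default_def chi_def)+

text \<open>Soundness is claimed only for entries that carry the code of a program. The premises of
  such an entry carry codes of subprograms or of the program itself, so spurious entries are never
  reached.\<close>

lemma derivation_ev:
  "derivation (ev_step (oracle_answer X)) L \<Longrightarrow> (encode c, xs, y) \<in> set L \<Longrightarrow> ev X c xs y"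
proof (induction L arbitrary: c xs y)
  case (Cons e L)
  have IH: "ev X c xs y" if "(encode c, xs, y) \<in> set L" for c xs y
    using Cons that by simp
  show ?case
  proof (cases "(encode c, xs, y) \<in> set L")
    case False
    then have step: "ev_step (oracle_answer X) L (encode c, xs, y)" using Cons.prems by auto
    show ?thesis
    proof (cases c)
      case (Comp f gs)
      obtain ys where ys: "(encode f, ys, y) \<in> set L" "length ys = length gs"
        "\<forall>i<length gs. (encode (gs ! i), xs, ys ! i) \<in> set L"
        using step[unfolded Comp ev_step_Comp] by blast
      show ?thesis
        unfolding Comp by (rule ev_comp[of _ _ _ ys]) (use ys IH in \<open>auto simp: list_all2_conv_all_nth\<close>)
    next
      case (Prec f g)
      then obtain n zs where xs: "xs = n # zs" using step ev_step_Prec_Nil by (cases xs) auto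
      show ?thesis
      proof (cases n)
        case 0
        then have "(encode f, zs, y) \<in> set L" using step by (simp only: Prec xs \<open>n = 0\<close> ev_step_Prec_0)
        then show ?thesis using IH unfolding Prec xs \<open>n = 0\<close> by (auto intro: ev_prec0)
      next
        case (Suc m)
        then obtain u where "(encode (Prec f g), m # zs, u) \<in> set L"
          "(encode g, u # m # zs, y) \<in> set L"
          using step unfolding Prec xs Suc ev_step_Prec_Suc by blast
        then show ?thesis using IH unfolding Prec xs Suc by (blast intro: ev_precS)
      qed
    next
      case (Mn f)
      have "(encode f, y # xs, 0) \<in> set L"
        "\<forall>m<y. \<exists>u. (encode f, m # xs, u) \<in> set L \<and> u \<noteq> 0"
        using step unfolding Mn ev_step_Mn by auto
      then show ?thesis unfolding Mn using IH by (blast intro: ev_mn)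
    next
      case Orc
      then show ?thesis using step ev_orc[of X] by (cases xs) (auto simp: ev_step_def chi_def)
    next
      case Suc_f
      then show ?thesis using step by (cases xs) (auto simp: ev_step_def intro: ev_suc)
    qed (use step in \<open>auto simp: ev_step_def nth_default_def intro: ev_zer ev_proj\<close>)
  qed (rule IH)
qed simp

section \<open>Finite strings as oracles and the use principle\<close>

definition prefix_of :: "nat list \<Rightarrow> nat set \<Rightarrow> bool" where
  "prefix_of \<sigma> X \<longleftrightarrow> (\<forall>i<length \<sigma>. \<sigma> ! i \<noteq> 0 \<longleftrightarrow> i \<in> X)"

text \<open>A query beyond the end of the string gets no answer at all, rather than a default one;
  this keeps halting monotone under extension.\<close>

definition string_answer :: "nat list \<Rightarrow> nat \<Rightarrow> nat \<Rightarrow> bool" where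
  "string_answer \<sigma> x y \<longleftrightarrow> x < length \<sigma> \<and> y = of_bool (nth_default 0 \<sigma> x \<noteq> 0)"

definition halts :: "nat list \<Rightarrow> nat \<Rightarrow> (nat \<times> nat list \<times> nat) list \<Rightarrow> bool" where
  "halts \<sigma> n w \<longleftrightarrow> derivation (ev_step (string_answer \<sigma>)) w \<and>
    (\<exists>e\<in>set w. fst e = n \<and> fst (snd e) = [n])"

lemma decidable_halts [computability]:
  fixes f :: "'a::coded \<Rightarrow> nat list"
  assumes "computable X f" "computable X g" "computable X h"
  shows "decidable X (\<lambda>x. halts (f x) (g x) (h x))"
proof -
  have "decidable X (\<lambda>p. halts (fst p) (fst (snd p)) (snd (snd p)))"
    unfolding halts_def ev_step_def string_answer_def Let_def by (intro computability)
  from decidable_compose[OF this computable_Pair[OF assms(1) computable_Pair[OF assms(2,3)]]]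
  show ?thesis by simp
qed

lemma halts_append: "halts \<sigma> n w \<Longrightarrow> halts (\<sigma> @ \<rho>) n w"
  unfolding halts_def
  by (auto intro!: derivation_ev_step_mono_oracle[where Q = "string_answer \<sigma>"]
      simp: string_answer_def nth_default_def nth_append)

lemma halts_ev:
  assumes "halts \<sigma> (encode c) w" "prefix_of \<sigma> X"
  shows "\<exists>y. ev X c [encode c] y"
proof -
  obtain y where w: "derivation (ev_step (string_answer \<sigma>)) w" "(encode c, [encode c], y) \<in> set w"
    using assms(1) unfolding halts_def by force
  have "string_answer \<sigma> x y \<Longrightarrow> oracle_answer X x y" for x y
    using assms(2) by (auto simp: string_answer_def prefix_of_def chi_def nth_default_def)
  then have "derivation (ev_step (oracle_answer X)) w"
    by (rule derivation_ev_step_mono_oracle[OF w(1)])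
  then show ?thesis using derivation_ev w(2) by blast
qed

definition initial_segment :: "nat set \<Rightarrow> nat \<Rightarrow> nat list" where
  "initial_segment X m = map (chi X) [0..<m]"

lemma prefix_of_initial_segment: "prefix_of (initial_segment X m) X"
  by (simp add: prefix_of_def initial_segment_def chi_def)

lemma computable_initial_segment [computability]:
  assumes "turing_le X Z" "computable Z f"
  shows "computable Z (\<lambda>x. initial_segment X (f x))"
proof -
  have "computable X (initial_segment X)"
    unfolding initial_segment_def by (intro computability)
  then show ?thesis using computable_relativize computable_compose assms by metis
qed

text \<open>A certificate has finitely many entries, and each asks at most about the head of its
  argument list.\<close>

lemma derivation_initial_segment:
  "derivation (ev_step (oracle_answer X)) L \<Longrightarrow>
    \<exists>m. \<forall>k\<ge>m. derivation (ev_step (string_answer (initial_segment X k))) L"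
proof (induction L)
  case (Cons e L)
  then obtain m where m: "\<And>k. k \<ge> m \<Longrightarrow> derivation (ev_step (string_answer (initial_segment X k))) L"
    by auto
  let ?m = "max m (Suc (hd (fst (snd e))))"
  have "ev_step (string_answer (initial_segment X k)) L e" if "k \<ge> ?m" for k
  proof -
    have "string_answer (initial_segment X k) (hd (fst (snd e))) (chi X (hd (fst (snd e))))"
      using that by (simp add: string_answer_def initial_segment_def nth_default_def chi_def)
    moreover have "ev_step (oracle_answer X) L e" using Cons.prems by simp
    ultimately show ?thesis by (elim ev_step_mono) auto
  qed
  then show ?case using m by (intro exI[of _ ?m]) simp
qed simp

lemma ev_halts:
  assumes "ev X c [encode c] y"
  shows "\<exists>m w. \<forall>k\<ge>m. halts (initial_segment X k) (encode c) w"
proof -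
  obtain w where w: "derivation (ev_step (oracle_answer X)) w" "(encode c, [encode c], y) \<in> set w"
    using ev_derivable[OF assms] unfolding derivable_def by blast
  then show ?thesis
    using derivation_initial_segment[OF w(1)] unfolding halts_def by force
qed

section \<open>The jump decides existential statements\<close>

definition is_code :: "nat \<Rightarrow> bool" where
  "is_code n \<longleftrightarrow> (\<exists>c. encode c = n)"

lemma is_code_iff: "is_code n \<longleftrightarrow> (\<exists>v. derivation code_step v \<and> n \<in> set v)"
  using derivable_encode derivation_code_step_encode
  unfolding is_code_def derivable_def by metis

lemma mem_jump_iff: "n \<in> jump X \<longleftrightarrow> is_code n \<and> (\<exists>m w. halts (initial_segment X m) n w)"
proof
  assume "n \<in> jump X"
  then show "is_code n \<and> (\<exists>m w. halts (initial_segment X m) n w)"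
    unfolding jump_def is_code_def using ev_halts by blast
next
  assume "is_code n \<and> (\<exists>m w. halts (initial_segment X m) n w)"
  then show "n \<in> jump X"
    unfolding jump_def is_code_def using halts_ev[OF _ prefix_of_initial_segment] by blast
qed

text \<open>The s-m-n argument: \<open>d x\<close> ignores its input and searches for a witness with
  \<open>x\<close> hardwired, so it halts on its own code iff a witness exists, and its code is
  computable from \<open>x\<close>.\<close>

lemma decidable_jump_Ex:
  fixes R :: "'a::coded \<Rightarrow> 'b::coded \<Rightarrow> bool"
  assumes R: "decidable X (\<lambda>p. R (fst p) (snd p))"
  shows "decidable (jump X) (\<lambda>x. \<exists>y. R x y)"
proof -
  from search_program[OF R] obtain c where c:
    "\<forall>x. ((\<exists>y. R x y) \<longrightarrow> (\<exists>y. R x y \<and> ev X c [enc x] (enc y))) \<and>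
      ((\<exists>z. ev X c [enc x] z) \<longrightarrow> (\<exists>y. R x y))" ..
  define d where "d x = Comp c [const_rf (enc x)]" for x :: 'a
  have "encode (d x) \<in> jump X \<longleftrightarrow> (\<exists>y. R x y)" for x
  proof
    assume "encode (d x) \<in> jump X"
    then obtain y where "ev X (d x) [encode (d x)] y"
      unfolding jump_def using inj_encode by blast
    then have "ev X c [enc x] y"
      unfolding d_def by (auto elim!: ev_CompE simp: list_all2_Cons1 dest: ev_functional[OF ev_const_rf])
    then show "\<exists>y. R x y" using c by blast
  next
    assume "\<exists>y. R x y"
    then obtain y where "ev X c [enc x] y" using c by blast
    then have "ev X (d x) [encode (d x)] y"
      unfolding d_def by (rule ev_comp1[OF ev_const_rf])
    then show "encode (d x) \<in> jump X" unfolding jump_def by blast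
  qed
  moreover have "computable (jump X) (\<lambda>x. encode (d x))"
  proof -
    \<comment> \<open>The code of a numeral program arises by primitive recursion; 3 is the tag of
      \<open>Comp\<close>.\<close>
    have "encode (const_rf n) =
        rec_nat (encode Zer) (\<lambda>_ r. prod_encode (3, prod_encode (encode Suc_f, enc [r]))) n" for n
      by (induction n) (simp_all add: enc_Cons enc_Nil)
    then have "encode (d x) = prod_encode (3, prod_encode (encode c, enc
        [rec_nat (encode Zer) (\<lambda>_ r. prod_encode (3, prod_encode (encode Suc_f, enc [r]))) (enc x)]))"
      for x by (simp add: d_def enc_Cons enc_Nil)
    then show ?thesis by (simp only:) (intro computability)
  qed
  then have "decidable (jump X) (\<lambda>x. encode (d x) \<in> jump X)" by (rule decidable_oracle)
  ultimately show ?thesis by simp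
qed

lemma decidable_Ex:
  fixes R :: "'a::coded \<Rightarrow> 'b::coded \<Rightarrow> bool"
  assumes "turing_le (jump X) Z" "decidable X (\<lambda>p. R (fst p) (snd p))"
  shows "decidable Z (\<lambda>x. \<exists>y. R x y)"
  using decidable_relativize[OF assms(1) decidable_jump_Ex[OF assms(2)]] .

lemma decidable_is_code: "turing_le (jump X) Z \<Longrightarrow> decidable Z is_code"
  unfolding is_code_iff by (erule decidable_Ex) (intro computability)

text \<open>Membership in \<open>jump X\<close> is existential over initial segments of
  \<open>X\<close>, and \<open>Y\<close> computes these.\<close>

lemma jump_mono:
  assumes "turing_le X Y"
  shows "turing_le (jump X) (jump Y)"
proof -
  have "decidable (jump Y) (\<lambda>n. is_code n \<and> (\<exists>q. halts (initial_segment X (fst q)) n (snd q)))"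
    by (intro decidable_and decidable_is_code[of Y] turing_le_refl decidable_jump_Ex)
      (intro computability assms)
  then show ?thesis unfolding turing_le_iff_decidable by (simp add: mem_jump_iff)
qed

subsection \<open>Forcing with thin sets\<close>

lemma computable2_computable:
  assumes "computable2 F" "computable X f" "computable X g"
  shows "computable X (\<lambda>x. F (f x) (g x))"
proof -
  obtain c where "\<And>i x. ev {} c [i, x] (F i x)"
    using assms(1) unfolding computable2_def by blast
  then have "computable {} (\<lambda>p. F (fst p) (snd p))"
    by (intro computable_binop[where op = F and c = c] computability) simp
  then have "computable X (\<lambda>p. F (fst p) (snd p))"
    by (rule computable_relativize[OF turing_le_empty])
  from computable_compose[OF this computable_Pair[OF assms(2,3)]] show ?thesis by simp
qed

text \<open>The string need not be binary and so may differ from the initial segment, but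
  \<open>string_answer\<close> only tests entries for being zero.\<close>

lemma halts_prefix_of:
  assumes "halts (initial_segment X (length \<sigma>)) n w" "prefix_of \<sigma> X"
  shows "halts \<sigma> n w"
proof -
  have "string_answer \<sigma> x y" if "string_answer (initial_segment X (length \<sigma>)) x y" for x y
    using that assms(2)
    by (auto simp: string_answer_def initial_segment_def nth_default_def prefix_of_def chi_def)
  then show ?thesis
    using assms(1) derivation_ev_step_mono_oracle unfolding halts_def by metis
qed

text \<open>\<open>h (k, c)\<close> is a supply of safe colours for column \<open>k\<close>,
  unbounded by \<open>h_ge\<close>. \<open>Z\<close> will be \<open>D\<close>, or the join of a path
  with \<open>0'\<close>.\<close>

locale thin_forcing =
  fixes Z :: "nat set" and F :: "nat \<Rightarrow> nat \<Rightarrow> nat" and h :: "nat \<times> nat \<Rightarrow> nat"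
  assumes Z: "turing_le (jump {}) Z"
    and F: "computable2 F"
    and h: "computable Z h"
    and h_ge: "\<And>k c. c \<le> h (k, c)"
    and h_infinite: "\<And>k c. infinite {x. F k x \<noteq> h (k, c)}"
begin

text \<open>Strings are conditions on \<open>join A\<close>, so a position decodes to a column and
  an element. Columns from \<open>length cs\<close> on are still free.\<close>

definition good :: "nat list \<Rightarrow> nat list \<Rightarrow> bool" where
  "good \<sigma> cs \<longleftrightarrow> (\<forall>j<length \<sigma>. nth_default 0 \<sigma> j \<noteq> 0 \<longrightarrow> fst (prod_decode j) < length cs \<longrightarrow>
    F (fst (prod_decode j)) (snd (prod_decode j)) \<noteq> nth_default 0 cs (fst (prod_decode j)))"

definition can_halt :: "nat list \<Rightarrow> nat list \<Rightarrow> nat \<Rightarrow> bool" where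
  "can_halt \<sigma> cs k \<longleftrightarrow> (\<exists>q. good (\<sigma> @ fst q) cs \<and> halts (\<sigma> @ fst q) k (snd q))"

definition bound :: "nat \<Rightarrow> nat" where
  "bound n = rec_nat 0 (\<lambda>j b. b + Suc (F (fst (prod_decode j)) (snd (prod_decode j)))) n"

text \<open>The state holds the string, the forbidden colours and a halting certificate. Writing the
  extension with \<open>drop\<close> avoids an existential quantifier over strings, and
  \<open>can_halt\<close> is decidable in \<open>Z\<close>, so the whole relation is. Serving column
  \<open>fst (prod_decode k)\<close> at stage \<open>k\<close> returns to every column infinitely
  often.\<close>

definition step ::
    "nat \<Rightarrow> nat list \<times> nat list \<times> (nat \<times> nat list \<times> nat) list \<Rightarrow>
      nat list \<times> nat list \<times> (nat \<times> nat list \<times> nat) list \<Rightarrow> bool" where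
  "step k s t \<longleftrightarrow>
    fst (snd t) = fst (snd s) @ [h (k, bound (length (fst s)))] \<and>
    fst t = fst s @ drop (length (fst s)) (fst t) \<and>
    good (fst t) (fst (snd t)) \<and>
    (\<exists>j<length (fst t). length (fst s) \<le> j \<and> nth_default 0 (fst t) j \<noteq> 0 \<and>
      fst (prod_decode j) = fst (prod_decode k)) \<and>
    (can_halt (fst t) (fst (snd t)) k \<longrightarrow> halts (fst t) k (snd (snd t)))"

lemma decidable_good [computability]:
  assumes "computable X f" "computable X g"
  shows "decidable X (\<lambda>x. good (f x) (g x))"
proof -
  have "decidable X (\<lambda>p. good (fst p) (snd p))"
    unfolding good_def by (intro computability computable2_computable[OF F])
  from decidable_compose[OF this computable_Pair[OF assms]] show ?thesis by simp
qed

lemma decidable_can_halt [computability]: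
  assumes "computable Z f" "computable Z g" "computable Z k"
  shows "decidable Z (\<lambda>x. can_halt (f x) (g x) (k x))"
proof -
  have "decidable Z (\<lambda>p. can_halt (fst p) (fst (snd p)) (snd (snd p)))"
    unfolding can_halt_def by (rule decidable_Ex[OF Z]) (intro computability)
  from decidable_compose[OF this computable_Pair[OF assms(1) computable_Pair[OF assms(2,3)]]]
  show ?thesis by simp
qed

lemma decidable_step: "decidable Z (\<lambda>p. step (fst (fst p)) (snd (fst p)) (snd p))"
  unfolding step_def bound_def
  by (intro computability computable_compose[OF h] computable2_computable[OF F])

lemma less_bound: "j < n \<Longrightarrow> F (fst (prod_decode j)) (snd (prod_decode j)) < bound n"
  by (induction n) (auto simp: bound_def less_Suc_eq)

lemma good_append_colour: "good \<sigma> (cs @ ds) \<Longrightarrow> good \<sigma> cs"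
  unfolding good_def by (auto simp: nth_default_append nth_append nth_default_def)

lemma good_append_zeros: "good \<sigma> cs \<Longrightarrow> good (\<sigma> @ replicate n 0) cs"
  unfolding good_def by (auto simp: nth_default_def nth_append split: if_splits)

lemma good_snoc:
  assumes "good \<sigma> cs" "length \<sigma> = prod_encode (i, x)" "i < length cs" "F i x \<noteq> cs ! i"
  shows "good (\<sigma> @ [b]) cs"
  using assms unfolding good_def by (auto simp: nth_default_def nth_append less_Suc_eq)

lemma can_halt_append: "can_halt (\<sigma> @ \<rho>) cs k \<Longrightarrow> can_halt \<sigma> cs k"
  unfolding can_halt_def by (metis append.assoc fst_conv snd_conv)

definition invariant :: "nat \<Rightarrow> nat list \<times> nat list \<times> (nat \<times> nat list \<times> nat) list \<Rightarrow> bool" where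
  "invariant k s \<longleftrightarrow> length (fst (snd s)) = k \<and> good (fst s) (fst (snd s)) \<and>
    (\<forall>i<k. infinite {x. F i x \<noteq> fst (snd s) ! i})"

text \<open>The new colour exceeds every value of \<open>F\<close> at the positions of
  \<open>\<sigma>\<close>, so what was put into column \<open>k\<close> while it was free remains
  admissible.\<close>

lemma good_new_colour:
  assumes "good \<sigma> cs" "length cs = k"
  shows "good \<sigma> (cs @ [h (k, bound (length \<sigma>))])"
  unfolding good_def
proof (intro allI impI)
  fix j
  assume j: "j < length \<sigma>" "nth_default 0 \<sigma> j \<noteq> 0"
    "fst (prod_decode j) < length (cs @ [h (k, bound (length \<sigma>))])"
  show "F (fst (prod_decode j)) (snd (prod_decode j)) \<noteq>
    nth_default 0 (cs @ [h (k, bound (length \<sigma>))]) (fst (prod_decode j))"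
  proof (cases "fst (prod_decode j) < k")
    case True
    then show ?thesis using assms j by (auto simp: good_def nth_default_def nth_append)
  next
    case False
    then have "fst (prod_decode j) = k" using j(3) assms(2) by simp
    moreover have "F (fst (prod_decode j)) (snd (prod_decode j)) < h (k, bound (length \<sigma>))"
      using less_bound[OF j(1)] h_ge[of "bound (length \<sigma>)" k] by simp
    ultimately show ?thesis using assms(2) by (simp add: nth_default_def nth_append)
  qed
qed

lemma step_exists:
  assumes "invariant k s"
  shows "\<exists>t. step k s t"
proof -
  obtain \<sigma> cs v where s: "s = (\<sigma>, cs, v)" by (cases s) auto
  define cs' where "cs' = cs @ [h (k, bound (length \<sigma>))]"
  have len: "length cs = k" and good: "good \<sigma> cs'"
    using assms good_new_colour unfolding invariant_def s cs'_def by auto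
  \<comment> \<open>A good halting extension is taken if there is one. Otherwise nothing is added
    and the implication holds vacuously.\<close>
  obtain \<rho> w where \<rho>: "good (\<sigma> @ \<rho>) cs'" "can_halt (\<sigma> @ \<rho>) cs' k \<longrightarrow> halts (\<sigma> @ \<rho>) k w"
  proof (cases "can_halt \<sigma> cs' k")
    case True
    then show ?thesis using that unfolding can_halt_def by blast
  next
    case False
    then show ?thesis using that[of "[]"] good by simp
  qed
  define i where "i = fst (prod_decode k)"
  \<comment> \<open>A component of a Cantor code does not exceed the code, so column
    \<open>i\<close> has its forbidden colour by now.\<close>
  have i: "i \<le> k" unfolding i_def using le_prod_encode_1 by (metis prod.collapse prod_decode_inverse)
  have "infinite {x. F i x \<noteq> cs' ! i}"
  proof (cases "i < k")
    case True
    then show ?thesis using assms unfolding invariant_def s cs'_def by (simp add: nth_append)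
  next
    case False
    then show ?thesis using i len h_infinite unfolding cs'_def by (simp add: nth_append)
  qed
  then obtain x where x: "length (\<sigma> @ \<rho>) \<le> x" "F i x \<noteq> cs' ! i"
    unfolding infinite_nat_iff_unbounded_le by blast
  define j where "j = prod_encode (i, x)"
  have j: "length (\<sigma> @ \<rho>) \<le> j" unfolding j_def using x(1) le_prod_encode_2 order_trans by blast
  \<comment> \<open>Zeros put nothing into any column, so padding up to \<open>j\<close> preserves
    goodness; the final 1 adds the element \<open>x\<close>, whose colour is allowed.\<close>
  define \<tau>0 where "\<tau>0 = (\<sigma> @ \<rho>) @ replicate (j - length (\<sigma> @ \<rho>)) 0"
  define \<tau> where "\<tau> = \<tau>0 @ [1]"
  have len0: "length \<tau>0 = j" unfolding \<tau>0_def using j by simp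
  have "good \<tau>0 cs'" unfolding \<tau>0_def by (rule good_append_zeros[OF \<rho>(1)])
  then have "good \<tau> cs'"
    unfolding \<tau>_def
    by (rule good_snoc[of _ _ i x]) (use len0 x(2) i len in \<open>auto simp: j_def cs'_def\<close>)
  \<comment> \<open>Adding \<open>x\<close> does not upset the decision: if \<open>\<tau>\<close>
    can still be made to halt, so could \<open>\<sigma> @ \<rho>\<close>, which then halts
    already.\<close>
  moreover have "\<exists>\<rho>'. \<tau> = (\<sigma> @ \<rho>) @ \<rho>'" unfolding \<tau>_def \<tau>0_def by simp
  then have "can_halt \<tau> cs' k \<longrightarrow> halts \<tau> k w"
    using \<rho>(2) can_halt_append halts_append by metis
  moreover have "\<tau> = \<sigma> @ drop (length \<sigma>) \<tau>" unfolding \<tau>_def \<tau>0_def by simp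
  moreover have "nth_default 0 \<tau> j \<noteq> 0" "j < length \<tau>" "length \<sigma> \<le> j"
    using len0 j unfolding \<tau>_def by (auto simp: nth_default_append)
  moreover have "fst (prod_decode j) = fst (prod_decode k)" by (simp add: j_def i_def)
  ultimately have "step k s (\<tau>, cs', w)"
    unfolding step_def s by (auto simp: cs'_def)
  then show ?thesis ..
qed

lemma invariant_step: "invariant k s \<Longrightarrow> step k s t \<Longrightarrow> invariant (Suc k) t"
  unfolding invariant_def step_def using h_infinite by (auto simp: less_Suc_eq nth_append)

theorem thin_sets:
  "\<exists>A. (\<forall>i. infinite (A i) \<and> thin_for (A i) (F i)) \<and> turing_le (jump (join A)) Z"
proof -
  have "invariant 0 ([], [], [])" by (simp add: invariant_def good_def)
  then obtain S where S: "computable Z S" "\<And>k. invariant k (S k)" "\<And>k. step k (S k) (S (Suc k))"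
    by (rule computable_dependent_choice[where R = step and I = invariant,
          OF decidable_step _ step_exists invariant_step]) blast+
  define str where "str k = fst (S k)" for k
  define col where "col k = fst (snd (S k))" for k
  have good: "good (str k) (col k)" and len_col: "length (col k) = k" for k
    using S(2) unfolding invariant_def str_def col_def by auto
  have str_ext: "\<exists>\<rho>. str m = str k @ \<rho>" if "k \<le> m" for k m
    using that
  proof (induction rule: dec_induct)
    case (step m)
    then show ?case using S(3)[of m] unfolding step_def str_def by (metis append.assoc)
  qed simp
  have col_ext: "\<exists>ds. col m = col k @ ds" if "k \<le> m" for k m
    using that
  proof (induction rule: dec_induct)
    case (step m)
    then show ?case using S(3)[of m] unfolding step_def col_def by (metis append.assoc)
  qed simp
  have new: "\<exists>j<length (str (Suc k)). length (str k) \<le> j \<and> str (Suc k) ! j \<noteq> 0 \<and>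
      fst (prod_decode j) = fst (prod_decode k)" for k
    using S(3)[of k] unfolding step_def str_def by (metis nth_default_nth)
  have len_str: "k \<le> length (str k)" for k
  proof (induction k)
    case (Suc k)
    then show ?case using new[of k] by auto
  qed simp
  define G where "G = {j. \<exists>k. j < length (str k) \<and> str k ! j \<noteq> 0}"
  have prefix: "prefix_of (str k) G" for k
  proof -
    have "str k ! j \<noteq> 0" if "j < length (str k)" "j < length (str m)" "str m ! j \<noteq> 0" for j m
      using that str_ext[of k m] str_ext[of m k] by (metis nat_le_linear nth_append)
    then show ?thesis unfolding prefix_of_def G_def by blast
  qed
  define A where "A i = {x. prod_encode (i, x) \<in> G}" for i
  have join: "join A = G"
    unfolding join_def A_def using prod_decode_inverse by (auto, metis surj_pair)
  have "infinite (A i)" for i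
  proof -
    have "\<exists>j\<ge>n. j \<in> prod_encode ` Pair i ` A i" for n
    proof -
      \<comment> \<open>This stage serves column \<open>i\<close>, and the string has length at
        least \<open>n\<close> by then.\<close>
      let ?k = "prod_encode (i, n)"
      obtain j where j: "length (str ?k) \<le> j" "j < length (str (Suc ?k))" "str (Suc ?k) ! j \<noteq> 0"
        "fst (prod_decode j) = i"
        using new[of ?k] by auto
      then have "j \<in> G" unfolding G_def by blast
      moreover have "j = prod_encode (i, snd (prod_decode j))"
        using j(4) by (metis prod.collapse prod_decode_inverse)
      ultimately have "j \<in> prod_encode ` Pair i ` A i" unfolding A_def by (metis CollectI imageI)
      moreover have "n \<le> j" using j(1) len_str[of ?k] le_prod_encode_2[of n i] by linarith
      ultimately show ?thesis by blast
    qed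
    then have "infinite (prod_encode ` Pair i ` A i)"
      unfolding infinite_nat_iff_unbounded_le by blast
    then show ?thesis by blast
  qed
  moreover have "thin_for (A i) (F i)" for i
    unfolding thin_for_def
  proof (intro exI ballI)
    fix x
    assume "x \<in> A i"
    then obtain k where k: "prod_encode (i, x) < length (str k)" "str k ! prod_encode (i, x) \<noteq> 0"
      unfolding A_def G_def by blast
    \<comment> \<open>The colour of column \<open>i\<close> is fixed at stage \<open>i\<close>, and
      \<open>x\<close> may have entered earlier; at the later of the two stages both are
      visible.\<close>
    define m where "m = max k (Suc i)"
    obtain \<rho> ds where "str m = str k @ \<rho>" "col m = col (Suc i) @ ds"
      using str_ext[of k m] col_ext[of "Suc i" m] unfolding m_def by auto
    then have "prod_encode (i, x) < length (str m)" "nth_default 0 (str m) (prod_encode (i, x)) \<noteq> 0"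
      "nth_default 0 (col m) i = col (Suc i) ! i"
      using k len_col[of "Suc i"] by (auto simp: nth_default_def nth_append)
    then show "F i x \<noteq> col (Suc i) ! i"
      using good[of m] len_col[of m] unfolding good_def m_def by fastforce
  qed
  moreover have "turing_le (jump G) Z"
  proof -
    \<comment> \<open>The state after stage \<open>n\<close> settles bit \<open>n\<close>. Every
      later string is an extension of its string and, as colours are only appended, good for its
      colours.\<close>
    have "n \<in> jump G \<longleftrightarrow> is_code n \<and> can_halt (str (Suc n)) (col (Suc n)) n" for n
    proof
      assume "n \<in> jump G"
      then obtain c where c: "encode c = n" "\<exists>y. ev G c [encode c] y" unfolding jump_def by auto
      then obtain m w where mw: "\<forall>k\<ge>m. halts (initial_segment G k) n w"
        using ev_halts by blast
      define K where "K = max m (Suc n)"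
      obtain \<rho> ds where K: "str K = str (Suc n) @ \<rho>" "col K = col (Suc n) @ ds"
        using str_ext[of "Suc n" K] col_ext[of "Suc n" K] unfolding K_def by auto
      have "halts (str K) n w"
      proof (rule halts_prefix_of[OF _ prefix])
        have "m \<le> length (str K)" using len_str[of K] unfolding K_def by simp
        then show "halts (initial_segment G (length (str K))) n w" using mw by blast
      qed
      moreover have "good (str K) (col (Suc n))" using good[of K] K(2) good_append_colour by simp
      ultimately have "can_halt (str (Suc n)) (col (Suc n)) n"
        unfolding can_halt_def K(1) by (intro exI[of _ "(\<rho>, w)"]) simp
      then show "is_code n \<and> can_halt (str (Suc n)) (col (Suc n)) n"
        using c(1) unfolding is_code_def by blast
    next
      assume n: "is_code n \<and> can_halt (str (Suc n)) (col (Suc n)) n"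
      then obtain c where c: "encode c = n" unfolding is_code_def by blast
      have "\<exists>w. halts (str (Suc n)) n w"
        using n S(3)[of n] unfolding step_def str_def col_def by blast
      then show "n \<in> jump G"
        using halts_ev[OF _ prefix] c unfolding jump_def by blast
    qed
    moreover have "decidable Z (\<lambda>n. is_code n \<and> can_halt (str (Suc n)) (col (Suc n)) n)"
      unfolding str_def col_def
      by (intro computability decidable_compose[OF decidable_is_code[OF Z]] computable_compose[OF S(1)])
    ultimately show ?thesis by (simp add: turing_le_iff_decidable)
  qed
  ultimately show ?thesis using join by auto
qed

end

subsection \<open>Binary trees and the low basis theorem\<close>

lemma length_initial_segment [simp]: "length (initial_segment B n) = n"
  by (simp add: initial_segment_def)

lemma nth_initial_segment: "i < n \<Longrightarrow> nth_default 0 (initial_segment B n) i = chi B i"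
  by (simp add: initial_segment_def nth_default_def)

lemma initial_segment_cong:
  "(\<And>i. i < n \<Longrightarrow> i \<in> B \<longleftrightarrow> i \<in> C) \<Longrightarrow> initial_segment B n = initial_segment C n"
  by (simp add: initial_segment_def chi_def)

lemma initial_segment_append:
  "m \<le> n \<Longrightarrow> initial_segment B n = initial_segment B m @ map (chi B) [m..<n]"
  unfolding initial_segment_def by (metis le0 map_append upt_add_eq_append le_add_diff_inverse)

text \<open>Binary trees are represented by predicates on strings over \<open>{0, 1}\<close>, restricted to strings of
  the form \<open>initial_segment B n\<close>.\<close>

definition binary_tree :: "(nat list \<Rightarrow> bool) \<Rightarrow> bool" where
  "binary_tree P \<longleftrightarrow> (\<forall>B m n. m \<le> n \<longrightarrow> P (initial_segment B n) \<longrightarrow> P (initial_segment B m))"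

definition infinite_tree :: "(nat list \<Rightarrow> bool) \<Rightarrow> bool" where
  "infinite_tree P \<longleftrightarrow> (\<forall>n. \<exists>B. P (initial_segment B n))"

definition tree_path :: "nat set \<Rightarrow> (nat list \<Rightarrow> bool) \<Rightarrow> bool" where
  "tree_path B P \<longleftrightarrow> (\<forall>n. P (initial_segment B n))"

lemma weak_koenig:
  assumes tree: "binary_tree P" and inf: "infinite_tree P"
  shows "\<exists>B. tree_path B P"
proof -
  \<comment> \<open>Only the first \<open>k\<close> bits of \<open>B\<close> matter: they have
    extensions of every length in the tree.\<close>
  define J where "J k B \<longleftrightarrow> (\<forall>n. \<exists>C. (\<forall>i<k. i \<in> C \<longleftrightarrow> i \<in> B) \<and> P (initial_segment C n))"
    for k :: nat and B
  have "\<exists>f. \<forall>k. J k (f k) \<and> (\<forall>i<k. i \<in> f (Suc k) \<longleftrightarrow> i \<in> f k)"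
  proof (rule dependent_nat_choice)
    show "\<exists>B. J 0 B" using inf unfolding J_def infinite_tree_def by simp
  next
    fix B k
    assume J: "J k B"
    show "\<exists>B'. J (Suc k) B' \<and> (\<forall>i<k. i \<in> B' \<longleftrightarrow> i \<in> B)"
    proof (rule ccontr)
      assume contra: "\<not> ?thesis"
      have "\<not> J (Suc k) (insert k B)" "\<not> J (Suc k) (B - {k})"
        using contra by auto
      then obtain n0 n1 where
        n0: "\<nexists>C. (\<forall>i<Suc k. i \<in> C \<longleftrightarrow> i \<in> insert k B) \<and> P (initial_segment C n0)" and
        n1: "\<nexists>C. (\<forall>i<Suc k. i \<in> C \<longleftrightarrow> i \<in> B - {k}) \<and> P (initial_segment C n1)"
        unfolding J_def not_all by (elim exE) (rule that)
      \<comment> \<open>A string reaching both levels at which the two one-bit extensions die out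
        contradicts the one that agrees with its own bit \<open>k\<close>.\<close>
      obtain C where C: "\<forall>i<k. i \<in> C \<longleftrightarrow> i \<in> B" "P (initial_segment C (max n0 n1))"
        using J unfolding J_def by blast
      have "P (initial_segment C n0)" "P (initial_segment C n1)"
        using C(2) tree unfolding binary_tree_def by (meson max.cobounded1 max.cobounded2)+
      show False
      proof (cases "k \<in> C")
        case True
        then have "\<forall>i<Suc k. i \<in> C \<longleftrightarrow> i \<in> insert k B" using C(1) by (simp add: less_Suc_eq)
        then show False using n0 \<open>P (initial_segment C n0)\<close> by blast
      next
        case False
        then have "\<forall>i<Suc k. i \<in> C \<longleftrightarrow> i \<in> B - {k}" using C(1) by (auto simp: less_Suc_eq)
        then show False using n1 \<open>P (initial_segment C n1)\<close> by blast
      qed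
    qed
  qed
  then obtain f where "\<forall>k. J k (f k) \<and> (\<forall>i<k. i \<in> f (Suc k) \<longleftrightarrow> i \<in> f k)" ..
  then have f: "J k (f k)" "i < k \<Longrightarrow> i \<in> f (Suc k) \<longleftrightarrow> i \<in> f k" for k i by simp_all
  have stable: "i \<in> f k \<longleftrightarrow> i \<in> f (Suc i)" if "i < k" for i k
    using Suc_leI[OF that] by (induction rule: dec_induct) (auto simp: f(2))
  define B where "B = {i. i \<in> f (Suc i)}"
  have "P (initial_segment B n)" for n
  proof -
    obtain C where C: "\<forall>i<n. i \<in> C \<longleftrightarrow> i \<in> f n" "P (initial_segment C n)"
      using f(1)[of n] unfolding J_def by blast
    have "initial_segment C n = initial_segment B n"
    proof (rule initial_segment_cong)
      show "i \<in> C \<longleftrightarrow> i \<in> B" if "i < n" for i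
        using C(1) stable[OF that] that unfolding B_def by blast
    qed
    then show ?thesis using C(2) by simp
  qed
  then show ?thesis unfolding tree_path_def by blast
qed

lemma map_of_bool_conv_initial_segment:
  "map of_bool s = initial_segment {i. i < length s \<and> s ! i} (length s)"
  by (rule nth_equalityI) (simp_all add: initial_segment_def chi_def)

text \<open>Transfer between 0-1 strings and Boolean lists. A number codes a node iff the list it
  codes has entries at most 1 and satisfies \<open>P\<close>.\<close>

lemma gg_path:
  assumes gg: "gg D Y" and P: "decidable Y P" and tree: "binary_tree P" and inf: "infinite_tree P"
  obtains B where "tree_path B P" "turing_le B D"
proof -
  define T :: "bool list set" where "T = {s. P (map of_bool s)}"
  have "is_tree T"
    unfolding is_tree_def T_def
  proof (intro ballI allI, simp)
    fix s n
    assume s: "P (map of_bool s)"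
    let ?B = "{i. i < length s \<and> s ! i}"
    have "map of_bool (take n s) = initial_segment ?B (min n (length s))"
      by (rule nth_equalityI) (simp_all add: initial_segment_def chi_def)
    moreover have "P (initial_segment ?B (length s))"
      using s by (simp add: map_of_bool_conv_initial_segment)
    ultimately show "P (map of_bool (take n s))"
      using tree unfolding binary_tree_def by (metis min.cobounded2)
  qed
  moreover have "infinite T"
  proof
    assume "finite T"
    then have "finite (length ` T)" by simp
    moreover have "n \<in> length ` T" for n
    proof -
      obtain B where B: "P (initial_segment B n)" using inf unfolding infinite_tree_def by blast
      have "map of_bool (map (\<lambda>i. i \<in> B) [0..<n]) = initial_segment B n"
        by (simp add: initial_segment_def chi_def)
      then have "map (\<lambda>i. i \<in> B) [0..<n] \<in> T" using B unfolding T_def by (simp del: map_map)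
      then show ?thesis by (metis (no_types) imageI length_map length_upt diff_zero)
    qed
    ultimately show False using finite_subset[of UNIV "length ` T"] by auto
  qed
  moreover have "turing_le (bl_code ` T) Y"
  proof -
    have code: "bl_code s = enc_list (map of_bool s)" for s
      unfolding bl_code_def of_bool_def ..
    have "n \<in> bl_code ` T \<longleftrightarrow> (\<forall>y\<in>set (dec n). y \<le> (1 :: nat)) \<and> P (dec n)" for n
    proof
      assume "n \<in> bl_code ` T"
      then show "(\<forall>y\<in>set (dec n). y \<le> (1 :: nat)) \<and> P (dec n)"
        by (auto simp: code T_def)
    next
      assume n: "(\<forall>y\<in>set (dec n). y \<le> (1 :: nat)) \<and> P (dec n)"
      define s where "s = map (\<lambda>y. y = (1 :: nat)) (dec n)"
      have s: "map of_bool s = (dec n :: nat list)"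
        using n unfolding s_def by (auto simp: le_Suc_eq intro!: map_idI)
      then have "bl_code s = n" by (simp add: code)
      moreover have "s \<in> T" using n s by (simp add: T_def)
      ultimately show "n \<in> bl_code ` T" by blast
    qed
    moreover have "decidable Y (\<lambda>n. (\<forall>y\<in>set (dec n). y \<le> (1 :: nat)) \<and> P (dec n))"
      by (intro computability decidable_compose[OF P])
    ultimately show ?thesis by (simp add: turing_le_iff_decidable)
  qed
  ultimately obtain p where p: "is_path p T" "turing_le {n. p n} D"
    using gg unfolding gg_def by blast
  have "map of_bool (map p [0..<n]) = initial_segment {n. p n} n" for n
    by (simp add: initial_segment_def chi_def)
  then have "tree_path {n. p n} P"
    using p(1) unfolding is_path_def T_def tree_path_def by (metis mem_Collect_eq)
  then show ?thesis using p(2) that by blast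
qed

text \<open>The initial segments of \<open>Y\<close> give a \<open>Y\<close>-computable tree whose
  only path is \<open>Y\<close>.\<close>

lemma gg_turing_le:
  assumes "gg D Y"
  shows "turing_le Y D"
proof -
  define P where "P \<sigma> \<longleftrightarrow> (\<forall>i<length \<sigma>. nth_default 0 \<sigma> i = chi Y i)" for \<sigma>
  have "decidable Y P" unfolding P_def by (intro computability)
  moreover have "binary_tree P"
    unfolding binary_tree_def P_def by (simp add: nth_initial_segment)
  moreover have "P (initial_segment Y n)" for n
    unfolding P_def by (simp add: nth_initial_segment)
  then have "infinite_tree P" unfolding infinite_tree_def by blast
  ultimately obtain B where B: "tree_path B P" "turing_le B D"
    using gg_path[OF assms] by blast
  have "i \<in> B \<longleftrightarrow> i \<in> Y" for i
    using B(1)[unfolded tree_path_def P_def, rule_format, of i "Suc i"]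
    by (simp add: nth_initial_segment chi_def split: if_splits)
  then have "B = Y" by blast
  then show ?thesis using B(2) by simp
qed

text \<open>Row 0 holds \<open>B\<close> and every other row a copy of \<open>Y\<close>. Since
  \<open>snd (prod_decode j) \<le> j\<close>, the first \<open>n\<close> bits of this join need only
  the first \<open>n\<close> bits of \<open>B\<close>.\<close>

definition oplus :: "nat set \<Rightarrow> nat set \<Rightarrow> nat set" where
  "oplus B Y = {j. if fst (prod_decode j) = 0 then snd (prod_decode j) \<in> B else snd (prod_decode j) \<in> Y}"

lemma turing_le_oplus: "turing_le B (oplus B Y)" "turing_le Y (oplus B Y)"
proof -
  have "decidable (oplus B Y) (\<lambda>n. prod_encode (0, n) \<in> oplus B Y)"
    "decidable (oplus B Y) (\<lambda>n. prod_encode (1, n) \<in> oplus B Y)"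
    by (intro computability)+
  then show "turing_le B (oplus B Y)" "turing_le Y (oplus B Y)"
    by (simp_all add: turing_le_iff_decidable oplus_def)
qed

definition oplus_string :: "nat set \<Rightarrow> nat list \<Rightarrow> nat list" where
  "oplus_string Y \<sigma> = map (\<lambda>j. if fst (prod_decode j) = 0 then nth_default 0 \<sigma> (snd (prod_decode j))
    else chi Y (snd (prod_decode j))) [0..<length \<sigma>]"

lemma oplus_string_initial_segment:
  "oplus_string Y (initial_segment B n) = initial_segment (oplus B Y) n"
proof -
  have "snd (prod_decode j) \<le> j" for j
    using le_prod_encode_2 by (metis prod.collapse prod_decode_inverse)
  then have "nth_default 0 (initial_segment B n) (snd (prod_decode j)) = chi B (snd (prod_decode j))"
    if "j < n" for j
    using that by (meson nth_initial_segment order_le_less_trans)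
  then show ?thesis
    unfolding oplus_string_def initial_segment_def[of "oplus B Y"]
    by (simp add: oplus_def chi_def)
qed

definition binary_strings :: "nat \<Rightarrow> nat list list" where
  "binary_strings n =
    rec_nat [[]] (\<lambda>_ r. map (\<lambda>s. s @ [0]) r @ map (\<lambda>s. s @ [1]) r) n"

lemma set_binary_strings: "set (binary_strings n) = range (\<lambda>B. initial_segment B n)"
proof (induction n)
  case 0
  show ?case by (auto simp: binary_strings_def initial_segment_def)
next
  case (Suc n)
  have *: "set (binary_strings (Suc n)) =
      (\<lambda>s. s @ [0]) ` set (binary_strings n) \<union> (\<lambda>s. s @ [1]) ` set (binary_strings n)"
    by (simp add: binary_strings_def)
  have 0: "initial_segment B n @ [0] = initial_segment (B - {n}) (Suc n)" for B
    by (auto simp: initial_segment_def chi_def)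
  have 1: "initial_segment B n @ [1] = initial_segment (insert n B) (Suc n)" for B
    by (auto simp: initial_segment_def chi_def)
  have 2: "initial_segment B (Suc n) = initial_segment B n @ [if n \<in> B then 1 else 0]" for B
    by (simp add: initial_segment_def chi_def)
  show ?case
  proof
    show "set (binary_strings (Suc n)) \<subseteq> range (\<lambda>B. initial_segment B (Suc n))"
      unfolding * Suc using 0 1 by auto
    show "range (\<lambda>B. initial_segment B (Suc n)) \<subseteq> set (binary_strings (Suc n))"
      unfolding * Suc using 2 by auto
  qed
qed

text \<open>A level has finitely many strings, so its being nonempty is a bounded statement, and
  infinity of the tree is \<Pi>1 in \<open>Y\<close>.\<close>

lemma decidable_infinite_tree:
  assumes "decidable Y (\<lambda>p :: 'a::coded \<times> nat list. Q (fst p) (snd p))"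
  shows "decidable (jump Y) (\<lambda>x. infinite_tree (Q x))"
proof -
  have "decidable (jump Y) (\<lambda>x. \<exists>n. \<not> (\<exists>\<sigma>\<in>set (binary_strings n). Q x \<sigma>))"
    unfolding binary_strings_def
    by (rule decidable_jump_Ex)
      (intro computability decidable_compose[OF assms, of "\<lambda>p. (fst (fst p), snd p)", simplified])
  then have "decidable (jump Y) (\<lambda>x. \<not> (\<exists>n. \<not> (\<exists>\<sigma>\<in>set (binary_strings n). Q x \<sigma>)))"
    by (rule decidable_not)
  then show ?thesis by (simp add: set_binary_strings infinite_tree_def)
qed

text \<open>Forcing with subtrees: \<open>e\<close> is accepted if the subtree on which computation
  \<open>e\<close> is never seen to halt is still infinite. \<open>jump Y\<close> decides this, so
  it computes the list of accepted indices and thereby the jump, although the path itself is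
  obtained noneffectively.\<close>

lemma low_basis:
  assumes P: "decidable Y P" and tree: "binary_tree P" and inf: "infinite_tree P"
  shows "\<exists>B. tree_path B P \<and> turing_le (jump (oplus B Y)) (jump Y)"
proof -
  \<comment> \<open>The length bounds both indices and certificates, which makes \<open>Q\<close>
    decidable in \<open>Y\<close> and lets level \<open>n\<close> depend only on indices below
    \<open>n\<close>.\<close>
  define Q where "Q es \<sigma> \<longleftrightarrow> P \<sigma> \<and> (\<forall>e\<in>set es. e < length \<sigma> \<longrightarrow>
    (\<forall>w<length \<sigma>. \<not> halts (oplus_string Y \<sigma>) e (dec w)))" for es \<sigma>
  have "decidable Y (\<lambda>p. Q (fst p) (snd p))"
    unfolding Q_def oplus_string_def by (intro computability decidable_compose[OF P])
  then have dec_inf: "decidable (jump Y) (\<lambda>es. infinite_tree (Q es))"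
    by (rule decidable_infinite_tree)
  have Q_tree: "binary_tree (Q es)" for es
    unfolding binary_tree_def Q_def oplus_string_initial_segment length_initial_segment
  proof (intro allI impI conjI ballI notI)
    fix B m n e w
    assume mn: "m \<le> n" and Q: "P (initial_segment B n) \<and> (\<forall>e\<in>set es. e < n \<longrightarrow>
      (\<forall>w<n. \<not> halts (initial_segment (oplus B Y) n) e (dec w)))"
    show "P (initial_segment B m)" using tree mn Q unfolding binary_tree_def by blast
    assume e: "e \<in> set es" "e < m" "w < m" and "halts (initial_segment (oplus B Y) m) e (dec w)"
    then have "halts (initial_segment (oplus B Y) n) e (dec w)"
      unfolding initial_segment_append[OF mn] by (intro halts_append)
    moreover have "e < n" "w < n" using e mn by simp_all
    ultimately show False using Q e(1) by blast
  qed
  define es where "es k = rec_nat [] (\<lambda>e r. if infinite_tree (Q (r @ [e])) then r @ [e] else r) k" for k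
  have es_Suc: "es (Suc e) = (if infinite_tree (Q (es e @ [e])) then es e @ [e] else es e)" for e
    by (simp add: es_def)
  have comp_es: "computable (jump Y) es"
    unfolding es_def by (intro computability decidable_compose[OF dec_inf])
  have inf_es: "infinite_tree (Q (es k))" for k
  proof (induction k)
    case 0
    show ?case using inf unfolding es_def Q_def by simp
  qed (simp add: es_Suc)
  have es_mono: "set (es k) \<subseteq> set (es m)" if "k \<le> m" for k m
    using that by (induction rule: dec_induct) (auto simp: es_Suc)
  have es_new: "e \<in> set (es (Suc e))" if "e \<in> set (es k)" for e k
    using that
  proof (induction k)
    case (Suc k)
    then show ?case by (auto simp: es_Suc[of k] split: if_splits)
  qed (simp add: es_def)
  \<comment> \<open>An index below \<open>n\<close> that is ever accepted already lies in
    \<open>es n\<close>, so at level \<open>n\<close> the single list \<open>es n\<close> stands for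
    all of them.\<close>
  have "\<exists>B. \<forall>k. Q (es k) (initial_segment B n)" for n
  proof -
    obtain B where B: "Q (es n) (initial_segment B n)"
      using inf_es unfolding infinite_tree_def by blast
    have "Q (es k) (initial_segment B n)" for k
      unfolding Q_def
    proof (intro conjI ballI impI)
      fix e
      assume e: "e \<in> set (es k)" "e < length (initial_segment B n)"
      then have "e \<in> set (es n)" using es_new es_mono[of "Suc e" n] by auto
      then show "\<forall>w<length (initial_segment B n).
          \<not> halts (oplus_string Y (initial_segment B n)) e (dec w)"
        using B e(2) unfolding Q_def by blast
    qed (use B in \<open>simp add: Q_def\<close>)
    then show ?thesis by blast
  qed
  then have "infinite_tree (\<lambda>\<sigma>. \<forall>k. Q (es k) \<sigma>)" unfolding infinite_tree_def by blast
  moreover have "binary_tree (\<lambda>\<sigma>. \<forall>k. Q (es k) \<sigma>)"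
    using Q_tree unfolding binary_tree_def by blast
  ultimately obtain B where "tree_path B (\<lambda>\<sigma>. \<forall>k. Q (es k) \<sigma>)"
    using weak_koenig by blast
  then have B: "Q (es k) (initial_segment B n)" for k n unfolding tree_path_def by blast
  have "e \<in> jump (oplus B Y) \<longleftrightarrow> is_code e \<and> e \<notin> set (es (Suc e))" for e
  proof (cases "e \<in> set (es (Suc e))")
    case True
    have "e \<notin> jump (oplus B Y)"
    proof
      assume "e \<in> jump (oplus B Y)"
      then obtain c y where c: "encode c = e" "ev (oplus B Y) c [encode c] y"
        unfolding jump_def by blast
      obtain m w where mw: "\<forall>k\<ge>m. halts (initial_segment (oplus B Y) k) e w"
        using ev_halts[OF c(2)] c(1) by blast
      define n where "n = Suc (m + e + enc w)"
      have "m \<le> n" "e < n" "enc w < n" unfolding n_def by simp_all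
      moreover have "halts (initial_segment (oplus B Y) n) e (dec (enc w))"
        using mw \<open>m \<le> n\<close> by simp
      ultimately show False
        using B[of "Suc e" n] True
        unfolding Q_def oplus_string_initial_segment length_initial_segment by blast
    qed
    then show ?thesis using True by blast
  next
    case False
    then have "\<not> infinite_tree (Q (es e @ [e]))" by (auto simp: es_Suc)
    \<comment> \<open>\<open>B\<close> leaves the rejected subtree at some level but stays in that
      of \<open>es e\<close>, so only a halting of \<open>e\<close> can be to blame.\<close>
    then obtain n where "\<not> Q (es e @ [e]) (initial_segment B n)" unfolding infinite_tree_def by blast
    then obtain w where "halts (initial_segment (oplus B Y) n) e w"
      using B[of e n] unfolding Q_def oplus_string_initial_segment by auto
    then show ?thesis using False mem_jump_iff by blast
  qed
  moreover have "decidable (jump Y) (\<lambda>e. is_code e \<and> e \<notin> set (es (Suc e)))"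
    by (intro computability decidable_is_code[of Y] turing_le_refl computable_compose[OF comp_es])
  ultimately have "turing_le (jump (oplus B Y)) (jump Y)"
    by (simp add: turing_le_iff_decidable)
  moreover have "tree_path B P" using B unfolding tree_path_def Q_def by blast
  ultimately show ?thesis by blast
qed

subsection \<open>Choosing the colours\<close>

definition colour :: "nat set \<Rightarrow> nat \<times> nat \<Rightarrow> nat" where
  "colour B p = snd p + snd p + chi B (prod_encode p)"

text \<open>\<open>F k\<close> cannot be eventually equal to both \<open>2 * c\<close> and \<open>2 * c + 1\<close>; bit \<open>prod_encode (k, c)\<close> of a
  path selects one of the two colours that \<open>F k\<close> avoids infinitely often.\<close>

definition avoids :: "(nat \<Rightarrow> nat \<Rightarrow> nat) \<Rightarrow> nat list \<Rightarrow> bool" where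
  "avoids F \<sigma> \<longleftrightarrow> (\<forall>n<length \<sigma>. \<forall>s<length \<sigma>. \<exists>x. s \<le> x \<and> F (fst (prod_decode n)) x \<noteq>
    snd (prod_decode n) + snd (prod_decode n) + nth_default 0 \<sigma> n)"

lemma avoids_initial_segment:
  "avoids F (initial_segment B m) \<longleftrightarrow>
    (\<forall>n<m. \<forall>s<m. \<exists>x\<ge>s. F (fst (prod_decode n)) x \<noteq> colour B (prod_decode n))"
  unfolding avoids_def colour_def by (simp add: nth_initial_segment)

text \<open>Both universal quantifiers are bounded by the length, leaving one unbounded existential
  quantifier for \<open>0'\<close>. Along a path the bounds disappear.\<close>

lemma decidable_avoids:
  assumes "computable2 F"
  shows "decidable (jump {}) (avoids F)"
proof -
  have R: "decidable (jump {}) (\<lambda>q. \<exists>x. fst q \<le> x \<and> F (fst (snd q)) x \<noteq> snd (snd q))"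
    by (rule decidable_jump_Ex) (intro computability computable2_computable[OF assms])
  show ?thesis
    unfolding avoids_def
    by (intro computability decidable_compose[OF R, of "\<lambda>p. (snd p,
        fst (prod_decode (snd (fst p))), snd (prod_decode (snd (fst p))) + snd (prod_decode (snd (fst p))) +
        nth_default 0 (fst (fst p)) (snd (fst p)))", simplified])
qed

lemma binary_tree_avoids: "binary_tree (avoids F)"
  unfolding binary_tree_def avoids_initial_segment by (meson order_less_le_trans)

lemma infinite_tree_avoids: "infinite_tree (avoids F)"
proof -
  \<comment> \<open>The bit is 1 exactly when the even colour is eventually constant and hence
    unsafe. This set need not be computable in \<open>0'\<close>; it only witnesses that the tree is
    infinite.\<close>
  define B where "B = {n. \<exists>s. \<forall>x\<ge>s. F (fst (prod_decode n)) x = 2 * snd (prod_decode n)}"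
  have "\<exists>x\<ge>s. F (fst (prod_decode n)) x \<noteq> colour B (prod_decode n)" for n s
  proof (cases "n \<in> B")
    case True
    then obtain s' where "\<forall>x\<ge>s'. F (fst (prod_decode n)) x = 2 * snd (prod_decode n)"
      unfolding B_def by blast
    then show ?thesis using True by (intro exI[of _ "max s s'"]) (simp add: colour_def chi_def)
  next
    case False
    then show ?thesis unfolding B_def colour_def chi_def by (auto simp flip: mult_2)
  qed
  then show ?thesis unfolding infinite_tree_def avoids_initial_segment by blast
qed

lemma thin_sets_of_path:
  assumes "turing_le (jump {}) Z" "computable2 F" "tree_path B (avoids F)" "turing_le B Z"
  shows "\<exists>A. (\<forall>i. infinite (A i) \<and> thin_for (A i) (F i)) \<and> turing_le (jump (join A)) Z"
proof -
  interpret thin_forcing Z F "colour B"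
  proof
    show "computable Z (colour B)"
      unfolding colour_def chi_eq_of_bool by (intro computability decidable_in[OF assms(4)])
    show "c \<le> colour B (k, c)" for k c unfolding colour_def by simp
    show "infinite {x. F k x \<noteq> colour B (k, c)}" for k c
      unfolding infinite_nat_iff_unbounded_le
    proof
      fix s
      have "\<exists>x\<ge>s. F (fst (prod_decode n)) x \<noteq> colour B (prod_decode n)" for n
        using assms(3) unfolding tree_path_def avoids_initial_segment
        by (metis less_add_Suc1 less_add_Suc2)
      from this[of "prod_encode (k, c)"] show "\<exists>x\<ge>s. x \<in> {x. F k x \<noteq> colour B (k, c)}" by simp
    qed
  qed (fact assms)+
  show ?thesis by (rule thin_sets)
qed

theorem theorem5p16:
  shows "(\<forall>D F. gg D (jump {}) \<and> computable2 F \<longrightarrow>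
            (\<exists>A. (\<forall>i. infinite (A i) \<and> thin_for (A i) (F i))
                 \<and> turing_le (jump (join A)) D))
       \<and> (\<forall>F. computable2 F \<longrightarrow>
            (\<exists>A. (\<forall>i. infinite (A i) \<and> thin_for (A i) (F i))
                 \<and> turing_equiv (jump (jump (join A))) (jump (jump {}))))"
proof (intro conjI allI impI)
  fix D F
  assume "gg D (jump {}) \<and> computable2 F"
  then have gg: "gg D (jump {})" and F: "computable2 F" by simp_all
  obtain B where "tree_path B (avoids F)" "turing_le B D"
    by (rule gg_path[OF gg decidable_avoids[OF F] binary_tree_avoids infinite_tree_avoids])
  then show "\<exists>A. (\<forall>i. infinite (A i) \<and> thin_for (A i) (F i)) \<and> turing_le (jump (join A)) D"
    by (rule thin_sets_of_path[OF gg_turing_le[OF gg] F])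
next
  fix F
  assume F: "computable2 F"
  obtain B where B: "tree_path B (avoids F)"
    and low: "turing_le (jump (oplus B (jump {}))) (jump (jump {}))"
    using low_basis[OF decidable_avoids[OF F] binary_tree_avoids infinite_tree_avoids] by blast
  \<comment> \<open>Here \<open>Z\<close> is the join of the path with \<open>0'\<close>; its jump
    lies below \<open>0''\<close> by \<open>low\<close>, so one more jump of the bound on
    \<open>A\<close> gives the claim.\<close>
  obtain A where A: "\<forall>i. infinite (A i) \<and> thin_for (A i) (F i)"
    and "turing_le (jump (join A)) (oplus B (jump {}))"
    using thin_sets_of_path[OF turing_le_oplus(2) F B turing_le_oplus(1)] by blast
  then have "turing_le (jump (jump (join A))) (jump (jump {}))"
    using turing_le_trans[OF jump_mono low] by blast
  moreover have "turing_le (jump (jump {})) (jump (jump (join A)))"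
    by (intro jump_mono turing_le_empty)
  ultimately show "\<exists>A. (\<forall>i. infinite (A i) \<and> thin_for (A i) (F i)) \<and>
      turing_equiv (jump (jump (join A))) (jump (jump {}))"
    using A unfolding turing_equiv_def by blast
qed

end
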